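(* Let $\{x^k\}_k$, $\{z^k\}_k$ be generated by the normal map-based stochastic proximal gradient method described in the context and assume conditions (A.1)–(A.4) hold. Then there exists a random variable $\psi^*:\Omega\to\mathbb{R}$ such that, as $k\to\infty$, \[ F^\lambda_{\mathrm{nor}}(z^k)\to0,\qquad F^\lambda_{\mathrm{nat}}(x^k)\to0,\qquad \psi(x^k)\to\psi^* \] almost surely on the event $\mathcal L=\{\omega: L(\omega)<\infty\}$.
   Context: Let $\varphi:\mathbb{R}^d\to(-\infty,\infty]$ be convex, lower semicontinuous and proper, let $f:\mathbb{R}^d\to\mathbb{R}$ be continuously differentiable on an open set containing $\mathrm{dom}\,\varphi$, and set $\psi=f+\varphi$. For $\lambda>0$ let $\mathrm{prox}_{\lambda\varphi}(x)=\operatorname{argmin}_y\{\varphi(y)+\frac{1}{2\lambda}\|x-y\|^2\}$, $\mathrm{env}_{\lambda\varphi}$ the Moreau envelope with $\nabla\mathrm{env}_{\lambda\varphi}(x)=(x-\mathrm{prox}_{\lambda\varphi}(x))/\lambda$, the normal map $F^\lambda_{\mathrm{nor}}(z)=\nabla f(\mathrm{prox}_{\lambda\varphi}(z))+\frac1\lambda(z-\mathrm{prox}_{\lambda\varphi}(z))$ and the natural residual $F^\lambda_{\mathrm{nat}}(x)=x-\mathrm{prox}_{\lambda\varphi}(x-\lambda\nabla f(x))$. Method: on a filtered probability space $(\Omega,\mathcal F,\{\mathcal F_k\}_k,\mathbb P)$, with $\lambda>0$, step sizes $\alpha_k>0$, deterministic $z^0$, $x^0=\mathrm{prox}_{\lambda\varphi}(z^0)$,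 and $\mathcal F_{k+1}$-measurable random vectors $g^k$, set $z^{k+1}=z^k-\alpha_k(g^k+\nabla\mathrm{env}_{\lambda\varphi}(z^k))$, $x^{k+1}=\mathrm{prox}_{\lambda\varphi}(z^{k+1})$. Let $e^k=g^k-\nabla f(x^k)$. $L(\omega)=\sup_{\bar x\in\mathrm{cl}(\mathrm{conv}\{x^k(\omega)\}_k)}\mathrm{lip}\,\nabla f(\bar x)$ with $\mathrm{lip}\,\nabla f(\bar x)=\limsup_{x,x'\to\bar x,\,x\ne x'}\|\nabla f(x)-\nabla f(x')\|/\|x-x'\|$. Conditions: (A.1) There is $\bar\psi\in\mathbb R$ with $\psi(x)\ge\bar\psi$ for all $x\in\mathrm{dom}\,\varphi$. (A.2) $\mathbb E[g^k\mid\mathcal F_k]=\nabla f(x^k)$ a.s. and there is $\{\sigma_k\}_k\subseteq\mathbb R_+$ with $\mathbb E[\|e^k\|^2]\le\sigma_k^2$ for all $k$. (A.3) $\sum_k\alpha_k=\infty$ and $\alpha_k\to0$. (A.4) There is a positive sequence $\{\beta_k\}_k$, non-decreasing for all $k$ sufficiently large, with $\sum_k\alpha_k^2\beta_k^2\sigma_k^2<\infty$. *)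

theory Defs
  imports "HOL-Analysis.Analysis" "HOL-Probability.Probability"
begin

definition edom :: "('a \<Rightarrow> ereal) \<Rightarrow> 'a set" where
  "edom \<phi> = {x. \<phi> x < \<infinity>}"

definition proper_fun :: "('a \<Rightarrow> ereal) \<Rightarrow> bool" where
  "proper_fun \<phi> \<longleftrightarrow> (\<forall>x. \<phi> x \<noteq> -\<infinity>) \<and> (\<exists>x. \<phi> x < \<infinity>)"

definition convex_efun :: "('a::real_vector \<Rightarrow> ereal) \<Rightarrow> bool" where
  "convex_efun \<phi> \<longleftrightarrow>
     (\<forall>x y t. 0 < t \<and> t < 1 \<longrightarrow>
        \<phi> ((1 - t) *\<^sub>R x + t *\<^sub>R y) \<le> ereal (1 - t) * \<phi> x + ereal t * \<phi> y)"

definition lsc_efun :: "('a::topological_space \<Rightarrow> ereal) \<Rightarrow> bool" where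
  "lsc_efun \<phi> \<longleftrightarrow> (\<forall>x. \<phi> x \<le> Liminf (at x) \<phi>)"

definition prox :: "real \<Rightarrow> ('a::real_normed_vector \<Rightarrow> ereal) \<Rightarrow> 'a \<Rightarrow> 'a" where
  "prox lam \<phi> x = (THE y. \<forall>u. \<phi> y + ereal (norm (x - y)^2 / (2 * lam))
                              \<le> \<phi> u + ereal (norm (x - u)^2 / (2 * lam)))"

definition env_grad :: "real \<Rightarrow> ('a::real_normed_vector \<Rightarrow> ereal) \<Rightarrow> 'a \<Rightarrow> 'a" where
  "env_grad lam \<phi> x = (1 / lam) *\<^sub>R (x - prox lam \<phi> x)"

definition F_nor :: "real \<Rightarrow> ('a::real_normed_vector \<Rightarrow> ereal) \<Rightarrow> ('a \<Rightarrow> 'a) \<Rightarrow> 'a \<Rightarrow> 'a" where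
  "F_nor lam \<phi> gf z = gf (prox lam \<phi> z) + (1 / lam) *\<^sub>R (z - prox lam \<phi> z)"

definition F_nat :: "real \<Rightarrow> ('a::real_normed_vector \<Rightarrow> ereal) \<Rightarrow> ('a \<Rightarrow> 'a) \<Rightarrow> 'a \<Rightarrow> 'a" where
  "F_nat lam \<phi> gf x = x - prox lam \<phi> (x - lam *\<^sub>R gf x)"

definition lip :: "('a::real_normed_vector \<Rightarrow> 'b::real_normed_vector) \<Rightarrow> 'a \<Rightarrow> ereal" where
  "lip G xb = Limsup (at (xb, xb) within {p. fst p \<noteq> snd p})
                 (\<lambda>(x, x'). ereal (norm (G x - G x') / norm (x - x')))"

end

theory Submission
  imports Defs
begin

text \<open>
  Write \<open>F\<close> for the normal map and \<open>e k\<close> for the gradient error. The noise is filtered through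
  \<open>w (k + 1) = (1 - min (\<alpha> k) 1) w k + \<alpha> k e k\<close>. Orthogonality of the errors to the past gives
  \<open>\<Sum>k. \<alpha> k (norm (w k))\<^sup>2 < \<infinity>\<close> almost surely, and a maximal inequality for \<open>\<Sum>k. \<alpha> k e k\<close> gives
  \<open>w k \<rightarrow> 0\<close>. The shifted sequence \<open>y k = z k + w k\<close> then obeys
  \<open>y (k + 1) = y k - \<alpha> k (F (y k) + \<epsilon> k)\<close> with \<open>norm (\<epsilon> k)\<close> at most a multiple of \<open>norm (w k)\<close>, so
  on each path one is left with a deterministic normal map iteration with square-summable errors.

  The proximal points of \<open>y k\<close> need not lie in the closed convex hull \<open>C\<close> of the iterates, which is
  the only place where the gradient is known to be Lipschitz. Therefore \<open>\<phi>\<close> is replaced, path by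
  path, by its restriction to \<open>C\<close>: this does not change the proximal points \<open>x k\<close> of \<open>z k\<close>, and it
  forces those of \<open>y k\<close> into \<open>C\<close>.

  For small \<open>\<tau>\<close> the merit function \<open>\<psi> \<circ> prox + (\<tau> \<lambda> / 2) (norm F)\<^sup>2\<close> decreases along \<open>y k\<close> by
  \<open>(\<tau> / 4) \<alpha> k (norm (F (y k)))\<^sup>2\<close> up to summable errors. So the merit values converge and
  \<open>\<Sum>k. \<alpha> k (norm (F (y k)))\<^sup>2 < \<infinity>\<close>; the increments of \<open>(norm (F (y k)))\<^sup>2\<close> are bounded above by a
  summable sequence, so it converges as well, and its limit is \<open>0\<close> because \<open>\<Sum>k. \<alpha> k = \<infinity>\<close>.
\<close>

subsection \<open>Proximal maps of convex lower semicontinuous functions\<close>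

text \<open>Both sides say that every set \<open>{x. a < \<phi> x}\<close> is open. The punctured
  filter \<open>at x\<close> loses nothing, since \<open>x\<close> itself belongs to that
  set.\<close>

lemma lsc_efun_iff_closed_sublevel:
  fixes \<phi> :: "'a::topological_space \<Rightarrow> ereal"
  shows "lsc_efun \<phi> \<longleftrightarrow> (\<forall>a. closed {x. \<phi> x \<le> a})"
proof
  assume lsc: "lsc_efun \<phi>"
  show "\<forall>a. closed {x. \<phi> x \<le> a}"
  proof
    fix a
    have "open {x. a < \<phi> x}"
    proof (subst open_subopen, intro ballI)
      fix x assume x: "x \<in> {x. a < \<phi> x}"
      then have "eventually (\<lambda>y. a < \<phi> y) (at x)"
        using lsc by (auto simp: lsc_efun_def le_Liminf_iff)
      then obtain S where "open S" "x \<in> S" "\<forall>y\<in>S. y \<noteq> x \<longrightarrow> a < \<phi> y"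
        by (auto simp: eventually_at_topological)
      then show "\<exists>T. open T \<and> x \<in> T \<and> T \<subseteq> {x. a < \<phi> x}"
        using x by (intro exI[of _ S]) auto
    qed
    moreover have "- {x. a < \<phi> x} = {x. \<phi> x \<le> a}" by auto
    ultimately show "closed {x. \<phi> x \<le> a}" by (metis closed_Compl)
  qed
next
  assume cl: "\<forall>a. closed {x. \<phi> x \<le> a}"
  show "lsc_efun \<phi>"
    unfolding lsc_efun_def le_Liminf_iff
  proof (intro allI impI)
    fix x a assume a: "a < \<phi> x"
    have "- {x. \<phi> x \<le> a} = {x. a < \<phi> x}" by auto
    with cl have "open {x. a < \<phi> x}" by (metis open_Compl)
    then show "eventually (\<lambda>y. a < \<phi> y) (at x)"
      using a by (auto simp: eventually_at_topological)
  qed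
qed

lemma proper_fun_eq_ereal:
  assumes "proper_fun \<phi>" "u \<in> edom \<phi>"
  shows "\<phi> u = ereal (real_of_ereal (\<phi> u))"
  using assms by (cases "\<phi> u") (auto simp: proper_fun_def edom_def)

lemma convex_edom:
  assumes "convex_efun \<phi>"
  shows "convex (edom \<phi>)"
proof (rule convexI)
  fix x y and u v :: real
  assume xy: "x \<in> edom \<phi>" "y \<in> edom \<phi>" and uv: "0 \<le> u" "0 \<le> v" "u + v = 1"
  have u: "u = 1 - v" using uv by simp
  consider "v = 0" | "v = 1" | "0 < v \<and> v < 1" using uv by linarith
  then show "u *\<^sub>R x + v *\<^sub>R y \<in> edom \<phi>"
  proof cases
    case 3
    then have "\<phi> ((1 - v) *\<^sub>R x + v *\<^sub>R y) \<le> ereal (1 - v) * \<phi> x + ereal v * \<phi> y"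
      using assms unfolding convex_efun_def by blast
    also have "\<dots> < \<infinity>"
      using xy 3 by (auto simp: edom_def ereal_mult_eq_PInfty less_top)
    finally show ?thesis unfolding edom_def u by simp
  qed (use xy uv in auto)
qed

lemma convex_efun_real:
  assumes "proper_fun \<phi>" "convex_efun \<phi>" "x \<in> edom \<phi>" "y \<in> edom \<phi>" "0 < t" "t < 1"
  shows "real_of_ereal (\<phi> ((1 - t) *\<^sub>R x + t *\<^sub>R y))
           \<le> (1 - t) * real_of_ereal (\<phi> x) + t * real_of_ereal (\<phi> y)"
proof -
  let ?v = "(1 - t) *\<^sub>R x + t *\<^sub>R y"
  have v: "?v \<in> edom \<phi>"
    using convex_edom[OF assms(2)] assms by (intro convexD) auto
  have "\<phi> ?v \<le> ereal (1 - t) * \<phi> x + ereal t * \<phi> y"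
    using assms unfolding convex_efun_def by blast
  then show ?thesis
    using proper_fun_eq_ereal[OF assms(1) v] proper_fun_eq_ereal[OF assms(1,3)]
      proper_fun_eq_ereal[OF assms(1,4)]
    by (metis ereal_less_eq(3) plus_ereal.simps(1) times_ereal.simps(1))
qed

text \<open>The bounds move and live in \<open>ereal\<close>, which covers both bounds falling to
  \<open>-\<infinity>\<close> and a minimizing sequence whose quadratic term moves as well.\<close>

lemma lsc_efun_limit_le:
  fixes \<phi> :: "'a::topological_space \<Rightarrow> ereal"
  assumes "lsc_efun \<phi>" "s \<longlonglongrightarrow> x" "c \<longlonglongrightarrow> (C::ereal)" "\<And>n. \<phi> (s n) \<le> c n"
  shows "\<phi> x \<le> C"
proof (rule dense_ge)
  fix a assume "C < a"
  then have "eventually (\<lambda>n. c n < a) sequentially" using assms(3) by (intro order_tendstoD(2))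
  then have "eventually (\<lambda>n. s n \<in> {x. \<phi> x \<le> a}) sequentially"
    by eventually_elim (use assms(4) in \<open>auto intro: order_trans less_imp_le\<close>)
  moreover have "closed {x. \<phi> x \<le> a}" using assms(1) lsc_efun_iff_closed_sublevel by blast
  ultimately have "x \<in> {x. \<phi> x \<le> a}"
    by (rule Lim_in_closed_set[rotated 1, OF _ sequentially_bot assms(2)])
  then show "\<phi> x \<le> a" by simp
qed

lemma lsc_efun_bdd_below_on_compact:
  fixes \<phi> :: "'a::metric_space \<Rightarrow> ereal"
  assumes "proper_fun \<phi>" "lsc_efun \<phi>" "compact K"
  obtains m :: real where "\<And>u. u \<in> K \<Longrightarrow> ereal m \<le> \<phi> u"
proof (rule ccontr)
  assume "\<not> thesis"
  then have "\<forall>n::nat. \<exists>u\<in>K. \<phi> u < ereal (- real n)"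
    using that by (meson not_le)
  then obtain s where s: "\<And>n. s n \<in> K" "\<And>n. \<phi> (s n) < ereal (- real n)" by metis
  then obtain l r where l: "l \<in> K" "strict_mono r" "(s \<circ> r) \<longlonglongrightarrow> l"
    using assms(3) unfolding compact_def by metis
  have "\<phi> ((s \<circ> r) n) \<le> - ereal (real n)" for n
  proof -
    have "\<phi> ((s \<circ> r) n) \<le> ereal (- real (r n))" using s(2)[of "r n"] by simp
    also have "\<dots> \<le> - ereal (real n)" using seq_suble[OF l(2), of n] by simp
    finally show ?thesis .
  qed
  moreover have "(\<lambda>n. - ereal (real n)) \<longlonglongrightarrow> - \<infinity>"
    using tendsto_uminus_ereal[OF id_nat_ereal_tendsto_PInf] by (simp add: comp_def)
  ultimately have "\<phi> l \<le> - \<infinity>"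
    using lsc_efun_limit_le[OF assms(2) l(3)] by blast
  then show False using assms(1) by (auto simp: proper_fun_def)
qed

text \<open>Plays the role of an affine minorant: \<open>\<phi>\<close> is bounded below on the unit
  ball around \<open>x0\<close>, and convexity carries this bound outwards along rays from
  \<open>x0\<close>.\<close>

lemma convex_efun_linear_minorant:
  fixes \<phi> :: "'a::euclidean_space \<Rightarrow> ereal"
  assumes "proper_fun \<phi>" "convex_efun \<phi>" "lsc_efun \<phi>" "x0 \<in> edom \<phi>"
  obtains c where "c \<ge> 0" "\<And>u. u \<in> edom \<phi> \<Longrightarrow> - c * (1 + norm (u - x0)) \<le> real_of_ereal (\<phi> u)"
proof -
  let ?r = "\<lambda>u. real_of_ereal (\<phi> u)"
  obtain m where m: "\<And>u. u \<in> cball x0 1 \<Longrightarrow> ereal m \<le> \<phi> u"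
    using lsc_efun_bdd_below_on_compact[OF assms(1,3) compact_cball] by metis
  have m': "m \<le> ?r u" if "u \<in> edom \<phi>" "norm (u - x0) \<le> 1" for u
    using m[of u] that proper_fun_eq_ereal[OF assms(1) that(1)]
    by (metis dist_norm ereal_less_eq(3) mem_cball norm_minus_commute)
  let ?c = "\<bar>m\<bar> + \<bar>?r x0\<bar>"
  have "- ?c * (1 + norm (u - x0)) \<le> ?r u" if u: "u \<in> edom \<phi>" for u
  proof (cases "norm (u - x0) \<le> 1")
    case True
    have "?c * 1 \<le> ?c * (1 + norm (u - x0))"
      by (intro mult_left_mono add_nonneg_nonneg abs_ge_zero) simp
    moreover have "m \<le> ?r u" using m' u True by blast
    ultimately show ?thesis unfolding mult_minus_left mult_1_right by linarith
  next
    case False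
    define \<rho> where "\<rho> = norm (u - x0)"
    have \<rho>: "\<rho> > 1" using False by (simp add: \<rho>_def)
    \<comment> \<open>The point of the segment from \<open>x0\<close> to \<open>u\<close> at
      distance one from \<open>x0\<close>, where the bound on the ball applies.\<close>
    define v where "v = (1 - 1 / \<rho>) *\<^sub>R x0 + (1 / \<rho>) *\<^sub>R u"
    have "v - x0 = (1 / \<rho>) *\<^sub>R (u - x0)" by (simp add: v_def algebra_simps)
    then have "norm (v - x0) \<le> 1" using \<rho> by (simp add: \<rho>_def)
    moreover have "v \<in> edom \<phi>" unfolding v_def
      using convex_edom[OF assms(2)] assms(4) u \<rho> by (intro convexD) auto
    ultimately have "m \<le> ?r v" using m' by blast
    also have "?r v \<le> (1 - 1 / \<rho>) * ?r x0 + (1 / \<rho>) * ?r u"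
      unfolding v_def using \<rho> assms u by (intro convex_efun_real) auto
    finally have "\<rho> * m \<le> \<rho> * ((1 - 1 / \<rho>) * ?r x0 + (1 / \<rho>) * ?r u)"
      using \<rho> by (intro mult_left_mono) auto
    also have "\<dots> = (\<rho> - 1) * ?r x0 + ?r u" using \<rho> by (simp add: field_simps)
    finally have "\<rho> * m - (\<rho> - 1) * ?r x0 \<le> ?r u" by simp
    moreover have "\<rho> * m \<ge> - (\<rho> * \<bar>m\<bar>)"
      using mult_left_mono[of "-\<bar>m\<bar>" m \<rho>] \<rho> by simp
    moreover have "(\<rho> - 1) * ?r x0 \<le> (\<rho> - 1) * \<bar>?r x0\<bar>"
      using \<rho> by (intro mult_left_mono abs_ge_self) simp
    moreover have "- ?c * (1 + \<rho>) = - (\<rho> * \<bar>m\<bar>) - (\<rho> - 1) * \<bar>?r x0\<bar> - \<bar>m\<bar> - 2 * \<bar>?r x0\<bar>"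
      by (simp add: algebra_simps)
    ultimately show ?thesis unfolding \<rho>_def[symmetric] by linarith
  qed
  moreover have "?c \<ge> 0" by (intro add_nonneg_nonneg abs_ge_zero)
  ultimately show thesis using that[of ?c] by blast
qed

text \<open>Direct method: the linear minorant makes the objective coercive, so a minimizing
  sequence has a convergent subsequence, and lower semicontinuity passes to its limit.\<close>

lemma prox_minimizer_exists:
  fixes \<phi> :: "'a::euclidean_space \<Rightarrow> ereal"
  assumes "proper_fun \<phi>" "convex_efun \<phi>" "lsc_efun \<phi>" and lam: "lam > 0"
  obtains p where "p \<in> edom \<phi>"
    "\<And>u. u \<in> edom \<phi> \<Longrightarrow> real_of_ereal (\<phi> p) + norm (x - p)^2 / (2 * lam)
                       \<le> real_of_ereal (\<phi> u) + norm (x - u)^2 / (2 * lam)"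
proof -
  define D where "D = edom \<phi>"
  define r where "r u = real_of_ereal (\<phi> u)" for u
  define \<Phi> where "\<Phi> u = r u + norm (x - u)^2 / (2 * lam)" for u
  obtain x0 where x0: "x0 \<in> D" using assms(1) by (auto simp: proper_fun_def edom_def D_def)
  obtain c where c: "c \<ge> 0" "\<And>u. u \<in> D \<Longrightarrow> - c * (1 + norm (u - x0)) \<le> r u"
    using convex_efun_linear_minorant[OF assms(1-3) x0[unfolded D_def]]
    by (auto simp: D_def r_def)
  define c' where "c' = c * (1 + norm (x - x0))"
  have lower: "norm (x - u)^2 / (2 * lam) - c * norm (x - u) - c' \<le> \<Phi> u" if "u \<in> D" for u
  proof -
    have "norm (u - x0) \<le> norm (x - u) + norm (x - x0)"
      using norm_triangle_ineq4[of "x - x0" "x - u"] by simp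
    then have "c * (1 + norm (u - x0)) \<le> c * (1 + (norm (x - u) + norm (x - x0)))"
      using c(1) by (intro mult_left_mono) auto
    then show ?thesis using c(2)[OF that] by (simp add: \<Phi>_def c'_def algebra_simps)
  qed
  \<comment> \<open>Beyond radius \<open>2 * lam * (c + 1)\<close> the quadratic term exceeds
    \<open>(c + 1) * norm (x - u)\<close>, which leaves one full \<open>norm (x - u)\<close> in the
    lower bound.\<close>
  have bounded: "norm (x - u) \<le> max (2 * lam * (c + 1)) (A + c')" if "u \<in> D" "\<Phi> u \<le> A" for u A
  proof (cases "norm (x - u) \<le> 2 * lam * (c + 1)")
    case False
    then have "norm (x - u) * (2 * lam * (c + 1)) \<le> norm (x - u) * norm (x - u)"
      by (intro mult_left_mono) auto
    then have "(c + 1) * norm (x - u) \<le> norm (x - u)^2 / (2 * lam)"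
      using lam by (simp add: field_simps power2_eq_square)
    then show ?thesis using lower[OF that(1)] that(2) by (simp add: algebra_simps)
  qed auto
  have bdd: "bdd_below (\<Phi> ` D)"
  proof (rule bdd_belowI2)
    fix u assume "u \<in> D"
    \<comment> \<open>Completing the square: \<open>lam * c\<close> is the distance at which the
      lower bound is smallest.\<close>
    have "0 \<le> (norm (x - u) - lam * c)^2 / (2 * lam)" using lam by simp
    also have "\<dots> = norm (x - u)^2 / (2 * lam) - c * norm (x - u) + lam * c^2 / 2"
      using lam by (simp add: power2_eq_square field_simps)
    finally show "- (lam * c^2 / 2) - c' \<le> \<Phi> u" using lower[OF \<open>u \<in> D\<close>] by simp
  qed
  define I where "I = Inf (\<Phi> ` D)"
  have "\<exists>u\<in>D. \<Phi> u < I + 1 / real (Suc n)" for n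
  proof -
    have "Inf (\<Phi> ` D) < I + 1 / real (Suc n)" by (simp add: I_def)
    then show ?thesis using cInf_lessD[of "\<Phi> ` D"] x0 by blast
  qed
  then obtain s where s: "\<And>n. s n \<in> D" "\<And>n. \<Phi> (s n) < I + 1 / real (Suc n)" by metis
  have "norm (x - s n) \<le> max (2 * lam * (c + 1)) (I + 1 + c')" for n
  proof (rule bounded[OF s(1)])
    have "1 / real (Suc n) \<le> 1" by simp
    then show "\<Phi> (s n) \<le> I + 1" using s(2)[of n] by linarith
  qed
  then have "range s \<subseteq> cball x (max (2 * lam * (c + 1)) (I + 1 + c'))"
    by (auto simp: dist_norm)
  then have "bounded (range s)" using bounded_cball bounded_subset by blast
  then obtain p q where q: "strict_mono q" "(s \<circ> q) \<longlonglongrightarrow> p"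
    using bounded_imp_convergent_subsequence by blast
  \<comment> \<open>Near-optimality minus the quadratic term bounds \<open>\<phi>\<close> along the
    subsequence, and this bound converges.\<close>
  let ?c = "\<lambda>n. I + 1 / real (Suc (q n)) - norm (x - s (q n))^2 / (2 * lam)"
  have "(\<lambda>n. 1 / real (Suc (q n))) \<longlonglongrightarrow> 0"
    using LIMSEQ_subseq_LIMSEQ[OF LIMSEQ_inverse_real_of_nat q(1)]
    by (simp add: comp_def inverse_eq_divide)
  then have "?c \<longlonglongrightarrow> I + 0 - norm (x - p)^2 / (2 * lam)"
    using q(2) lam unfolding comp_def by (intro tendsto_intros) auto
  then have "(\<lambda>n. ereal (?c n)) \<longlonglongrightarrow> ereal (I - norm (x - p)^2 / (2 * lam))" by simp
  moreover have "\<phi> ((s \<circ> q) n) \<le> ereal (?c n)" for n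
    using s(1)[of "q n"] s(2)[of "q n"] proper_fun_eq_ereal[OF assms(1), of "s (q n)"]
    by (simp add: D_def \<Phi>_def r_def) (metis add_diff_cancel diff_mono ereal_less_eq(3) less_imp_le order_refl)
  ultimately have p: "\<phi> p \<le> ereal (I - norm (x - p)^2 / (2 * lam))"
    using lsc_efun_limit_le[OF assms(3) q(2)] by blast
  then have "p \<in> D" by (auto simp: D_def edom_def)
  then have "r p \<le> I - norm (x - p)^2 / (2 * lam)"
    using p proper_fun_eq_ereal[OF assms(1), of p] by (metis D_def ereal_less_eq(3) r_def)
  then have "\<Phi> p \<le> I" by (simp add: \<Phi>_def)
  then have "\<Phi> p \<le> \<Phi> u" if "u \<in> D" for u
    using cInf_lower[OF _ bdd] that unfolding I_def by (meson image_eqI order_trans)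
  then show thesis using that[of p] \<open>p \<in> D\<close> by (simp add: D_def \<Phi>_def r_def)
qed

text \<open>Compare \<open>p\<close> with the points of the segment towards \<open>u\<close>, divide
  by \<open>t\<close> and let \<open>t\<close> decrease to zero; the quadratic remainder
  \<open>t * B\<close> disappears.\<close>

lemma prox_minimizer_variational:
  fixes \<phi> :: "'a::real_inner \<Rightarrow> ereal"
  assumes "proper_fun \<phi>" "convex_efun \<phi>" and lam: "lam > 0"
    and p: "p \<in> edom \<phi>"
    and min: "\<And>u. u \<in> edom \<phi> \<Longrightarrow> real_of_ereal (\<phi> p) + norm (x - p)^2 / (2 * lam)
                       \<le> real_of_ereal (\<phi> u) + norm (x - u)^2 / (2 * lam)"
    and u: "u \<in> edom \<phi>"
  shows "real_of_ereal (\<phi> p) + (x - p) \<bullet> (u - p) / lam \<le> real_of_ereal (\<phi> u)"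
proof -
  let ?r = "\<lambda>u. real_of_ereal (\<phi> u)"
  define A where "A = ?r u - ?r p - (x - p) \<bullet> (u - p) / lam"
  define B where "B = norm (u - p)^2 / (2 * lam)"
  have step: "0 \<le> A + t * B" if t: "0 < t" "t < 1" for t
  proof -
    let ?v = "(1 - t) *\<^sub>R p + t *\<^sub>R u"
    have "?v \<in> edom \<phi>"
      using convex_edom[OF assms(2)] p u t by (intro convexD) auto
    then have "?r p + norm (x - p)^2 / (2 * lam) \<le> ?r ?v + norm (x - ?v)^2 / (2 * lam)"
      by (rule min)
    also have "?r ?v \<le> (1 - t) * ?r p + t * ?r u"
      using convex_efun_real[OF assms(1,2) p u t] .
    also have "x - ?v = (x - p) - t *\<^sub>R (u - p)" by (simp add: algebra_simps)
    also have "norm ((x - p) - t *\<^sub>R (u - p))^2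
        = norm (x - p)^2 - 2 * t * ((x - p) \<bullet> (u - p)) + t^2 * norm (u - p)^2"
      by (simp only: power2_norm_eq_inner inner_diff_left inner_diff_right inner_scaleR_left
          inner_scaleR_right) (simp add: inner_commute power2_eq_square algebra_simps)
    finally have "0 \<le> t * (?r u - ?r p)
        + (t^2 * norm (u - p)^2 - 2 * t * ((x - p) \<bullet> (u - p))) / (2 * lam)"
      by (simp add: algebra_simps add_divide_distrib diff_divide_distrib)
    also have "\<dots> = t * (A + t * B)"
      using lam by (simp add: A_def B_def field_simps power2_eq_square)
    finally have "0 \<le> t * (A + t * B)" .
    then show ?thesis using t by (simp add: zero_le_mult_iff)
  qed
  have "((\<lambda>t. A + t * B) \<longlongrightarrow> A + 0 * B) (at_right 0)" by (intro tendsto_intros)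
  moreover have "eventually (\<lambda>t. 0 \<le> A + t * B) (at_right (0::real))"
    unfolding eventually_at_right_field by (intro exI[of _ 1]) (auto intro: step)
  ultimately have "0 \<le> A + 0 * B"
    by (intro tendsto_lowerbound) auto
  then show ?thesis by (simp add: A_def)
qed

text \<open>Expanding the square turns the inequality into optimality of \<open>p\<close> with the
  surplus \<open>norm (u - p)^2 / (2 * lam)\<close>. The surplus gives the uniqueness that the
  \<open>THE\<close> in \<open>prox\<close> asks for.\<close>

lemma variational_imp_prox:
  fixes \<phi> :: "'a::real_inner \<Rightarrow> ereal"
  assumes proper: "proper_fun \<phi>" and lam: "lam > 0" and p: "p \<in> edom \<phi>"
    and var: "\<And>u. u \<in> edom \<phi> \<Longrightarrow>
           real_of_ereal (\<phi> p) + (x - p) \<bullet> (u - p) / lam \<le> real_of_ereal (\<phi> u)"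
  shows "prox lam \<phi> x = p"
proof -
  let ?r = "\<lambda>u. real_of_ereal (\<phi> u)"
  have gap: "?r p + norm (x - p)^2 / (2 * lam) + norm (u - p)^2 / (2 * lam)
           \<le> ?r u + norm (x - u)^2 / (2 * lam)" if "u \<in> edom \<phi>" for u
  proof -
    have "x - u = (x - p) - (u - p)" by simp
    then have "norm (x - u)^2 = norm (x - p)^2 - 2 * ((x - p) \<bullet> (u - p)) + norm (u - p)^2"
      by (simp only: power2_norm_eq_inner inner_diff_left inner_diff_right)
        (simp add: inner_commute algebra_simps)
    then have "norm (x - u)^2 / (2 * lam)
        = norm (x - p)^2 / (2 * lam) - (x - p) \<bullet> (u - p) / lam + norm (u - p)^2 / (2 * lam)"
      using lam by (simp add: field_simps)
    then show ?thesis using var[OF that] by linarith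
  qed
  show ?thesis
    unfolding prox_def
  proof (rule the_equality)
    show "\<forall>u. \<phi> p + ereal (norm (x - p)^2 / (2 * lam)) \<le> \<phi> u + ereal (norm (x - u)^2 / (2 * lam))"
    proof
      fix u
      show "\<phi> p + ereal (norm (x - p)^2 / (2 * lam)) \<le> \<phi> u + ereal (norm (x - u)^2 / (2 * lam))"
      proof (cases "u \<in> edom \<phi>")
        case True
        have "0 \<le> norm (u - p)^2 / (2 * lam)" using lam by simp
        then have "?r p + norm (x - p)^2 / (2 * lam) \<le> ?r u + norm (x - u)^2 / (2 * lam)"
          using gap[OF True] by linarith
        then show ?thesis
          using proper_fun_eq_ereal[OF proper True] proper_fun_eq_ereal[OF proper p]
          by (metis ereal_less_eq(3) plus_ereal.simps(1))
      next
        case False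
        then show ?thesis by (simp add: edom_def)
      qed
    qed
  next
    fix q assume q: "\<forall>u. \<phi> q + ereal (norm (x - q)^2 / (2 * lam)) \<le> \<phi> u + ereal (norm (x - u)^2 / (2 * lam))"
    then have le: "\<phi> q + ereal (norm (x - q)^2 / (2 * lam)) \<le> \<phi> p + ereal (norm (x - p)^2 / (2 * lam))"
      by blast
    also have "\<dots> < \<infinity>" using p by (simp add: edom_def less_top)
    finally have qD: "q \<in> edom \<phi>" by (simp add: edom_def less_top)
    have "?r q + norm (x - q)^2 / (2 * lam) \<le> ?r p + norm (x - p)^2 / (2 * lam)"
      using le proper_fun_eq_ereal[OF proper qD] proper_fun_eq_ereal[OF proper p]
      by (metis ereal_less_eq(3) plus_ereal.simps(1))
    then have "norm (q - p)^2 / (2 * lam) \<le> 0" using gap[OF qD] by linarith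
    then show "q = p" using lam by (simp add: divide_le_0_iff)
  qed
qed

lemma
  fixes \<phi> :: "'a::euclidean_space \<Rightarrow> ereal"
  assumes "proper_fun \<phi>" "convex_efun \<phi>" "lsc_efun \<phi>" "lam > 0"
  shows prox_in_edom: "prox lam \<phi> x \<in> edom \<phi>"
    and prox_variational: "u \<in> edom \<phi> \<Longrightarrow> real_of_ereal (\<phi> (prox lam \<phi> x))
          + (x - prox lam \<phi> x) \<bullet> (u - prox lam \<phi> x) / lam \<le> real_of_ereal (\<phi> u)"
proof -
  obtain p where p: "p \<in> edom \<phi>"
    "\<And>u. u \<in> edom \<phi> \<Longrightarrow> real_of_ereal (\<phi> p) + norm (x - p)^2 / (2 * lam)
                       \<le> real_of_ereal (\<phi> u) + norm (x - u)^2 / (2 * lam)"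
    using prox_minimizer_exists[OF assms] by metis
  note var = prox_minimizer_variational[OF assms(1,2,4) p]
  have "prox lam \<phi> x = p" using variational_imp_prox[OF assms(1,4) p(1) var] .
  then show "prox lam \<phi> x \<in> edom \<phi>"
    and "u \<in> edom \<phi> \<Longrightarrow> real_of_ereal (\<phi> (prox lam \<phi> x))
          + (x - prox lam \<phi> x) \<bullet> (u - prox lam \<phi> x) / lam \<le> real_of_ereal (\<phi> u)"
    using p(1) var by auto
qed

text \<open>The sum of \<open>\<phi>\<close> and the indicator function of \<open>C\<close> in the
  sense of convex analysis, zero on \<open>C\<close> and infinite outside.\<close>

definition restrict_efun :: "'a set \<Rightarrow> ('a \<Rightarrow> ereal) \<Rightarrow> 'a \<Rightarrow> ereal" where
  "restrict_efun C \<phi> u = (if u \<in> C then \<phi> u else \<infinity>)"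

lemma edom_restrict_efun: "edom (restrict_efun C \<phi>) = C \<inter> edom \<phi>"
  by (auto simp: edom_def restrict_efun_def)

lemma restrict_efun_in: "u \<in> C \<Longrightarrow> restrict_efun C \<phi> u = \<phi> u"
  by (simp add: restrict_efun_def)

lemma proper_restrict_efun:
  assumes "proper_fun \<phi>" "C \<inter> edom \<phi> \<noteq> {}"
  shows "proper_fun (restrict_efun C \<phi>)"
  using assms by (auto simp: proper_fun_def restrict_efun_def edom_def)

lemma convex_restrict_efun:
  fixes \<phi> :: "'a::real_vector \<Rightarrow> ereal"
  assumes "proper_fun \<phi>" "convex_efun \<phi>" "convex C"
  shows "convex_efun (restrict_efun C \<phi>)"
  unfolding convex_efun_def
proof (intro allI impI)
  fix x y :: 'a and t :: real assume t: "0 < t \<and> t < 1"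
  let ?v = "(1 - t) *\<^sub>R x + t *\<^sub>R y"
  show "restrict_efun C \<phi> ?v
     \<le> ereal (1 - t) * restrict_efun C \<phi> x + ereal t * restrict_efun C \<phi> y"
  proof (cases "x \<in> C \<and> y \<in> C")
    case True
    then have "?v \<in> C" using t assms(3) by (intro convexD) auto
    then show ?thesis using True t assms(2) by (simp add: restrict_efun_def convex_efun_def)
  next
    case False
    have "restrict_efun C \<phi> u \<noteq> - \<infinity>" for u
      using assms(1) by (auto simp: restrict_efun_def proper_fun_def)
    moreover have "restrict_efun C \<phi> x = \<infinity> \<or> restrict_efun C \<phi> y = \<infinity>"
      using False by (auto simp: restrict_efun_def)
    ultimately have "ereal (1 - t) * restrict_efun C \<phi> x + ereal t * restrict_efun C \<phi> y = \<infinity>"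
      using t by (auto simp: ereal_mult_eq_PInfty ereal_mult_eq_MInfty)
    then show ?thesis by (metis ereal_less_eq(1))
  qed
qed

lemma lsc_restrict_efun:
  assumes "lsc_efun \<phi>" "closed C"
  shows "lsc_efun (restrict_efun C \<phi>)"
  unfolding lsc_efun_iff_closed_sublevel
proof
  fix a
  show "closed {x. restrict_efun C \<phi> x \<le> a}"
  proof (cases "a = \<infinity>")
    case False
    then have "{x. restrict_efun C \<phi> x \<le> a} = C \<inter> {x. \<phi> x \<le> a}"
      by (auto simp: restrict_efun_def)
    then show ?thesis using assms lsc_efun_iff_closed_sublevel[of \<phi>] by auto
  qed simp
qed

text \<open>Restriction only removes competitors \<open>u\<close> from the variational inequality of
  \<open>\<phi>\<close> and keeps the values on \<open>C\<close>, so the old proximal point still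
  passes the test.\<close>

lemma prox_restrict_efun:
  fixes \<phi> :: "'a::euclidean_space \<Rightarrow> ereal"
  assumes "proper_fun \<phi>" "convex_efun \<phi>" "lsc_efun \<phi>" "lam > 0" "prox lam \<phi> x \<in> C"
  shows "prox lam (restrict_efun C \<phi>) x = prox lam \<phi> x"
proof (rule variational_imp_prox)
  have "prox lam \<phi> x \<in> edom \<phi>" by (intro prox_in_edom assms)
  then show "prox lam \<phi> x \<in> edom (restrict_efun C \<phi>)" "proper_fun (restrict_efun C \<phi>)"
    using assms by (auto simp: edom_restrict_efun intro!: proper_restrict_efun)
  fix u assume "u \<in> edom (restrict_efun C \<phi>)"
  then show "real_of_ereal (restrict_efun C \<phi> (prox lam \<phi> x))
      + (x - prox lam \<phi> x) \<bullet> (u - prox lam \<phi> x) / lam \<le> real_of_ereal (restrict_efun C \<phi> u)"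
    using prox_variational[OF assms(1-4)] assms(5)
    by (auto simp: edom_restrict_efun restrict_efun_in)
qed (rule assms)

subsection \<open>Descent of the merit function\<close>

text \<open>Subtracting the partial sums of \<open>b\<close> leaves a sequence that decreases from
  \<open>N\<close> on and is bounded below.\<close>

lemma convergent_if_summable_increments:
  fixes u b :: "nat \<Rightarrow> real"
  assumes incr: "\<And>k. N \<le> k \<Longrightarrow> u (Suc k) \<le> u k + b k"
    and "summable b" and lower: "\<And>k. l \<le> u k"
  shows "convergent u"
proof -
  define s where "s k = (\<Sum>i<k. b i)" for k
  have s: "convergent s" using assms(2) unfolding summable_iff_convergent s_def .
  then obtain B where B: "\<And>k. \<bar>s k\<bar> \<le> B"
    using convergent_imp_Bseq[OF s] by (auto simp: Bseq_def)
  define v where "v k = u (k + N) - s (k + N)" for k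
  have "decseq v"
    unfolding decseq_Suc_iff
  proof
    fix n
    show "v (Suc n) \<le> v n" using incr[of "n + N"] by (simp add: v_def s_def)
  qed
  moreover have "l - B \<le> v k" for k
    using lower[of "k + N"] B[of "k + N"] by (simp add: v_def)
  ultimately have "convergent v" using decseq_convergent convergent_def by metis
  moreover have "convergent (\<lambda>k. s (k + N))"
    using s by (subst convergent_ignore_initial_segment)
  ultimately have "convergent (\<lambda>k. v k + s (k + N))" by (rule convergent_add)
  then have "convergent (\<lambda>k. u (k + N))" by (simp add: v_def)
  then show ?thesis by (subst (asm) convergent_ignore_initial_segment)
qed

text \<open>A positive limit \<open>a\<close> would give
  \<open>\<alpha> k \<le> (2 / a) * (\<alpha> k * t k)\<close> eventually, and \<alpha> would be
  summable.\<close>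

lemma summable_weighted_imp_null:
  fixes t \<alpha> :: "nat \<Rightarrow> real"
  assumes "convergent t" "\<And>k. t k \<ge> 0" "\<And>k. \<alpha> k \<ge> 0"
    and sum: "summable (\<lambda>k. \<alpha> k * t k)"
    and div: "filterlim (\<lambda>n. \<Sum>k<n. \<alpha> k) at_top sequentially"
  shows "t \<longlonglongrightarrow> 0"
proof -
  obtain a where a: "t \<longlonglongrightarrow> a" using assms(1) by (auto simp: convergent_def)
  have "a \<ge> 0" using a assms(2) by (intro LIMSEQ_le_const) auto
  moreover have "\<not> a > 0"
  proof
    assume "a > 0"
    then have "eventually (\<lambda>k. a / 2 < t k) sequentially"
      using order_tendstoD(1)[OF a, of "a / 2"] by simp
    then have "eventually (\<lambda>k. norm (\<alpha> k) \<le> (2 / a) * (\<alpha> k * t k)) sequentially"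
    proof eventually_elim
      case (elim k)
      then have "\<alpha> k * 1 \<le> \<alpha> k * ((2 / a) * t k)"
        using \<open>a > 0\<close> assms(3) by (intro mult_left_mono) (auto simp: field_simps)
      then show ?case using assms(3)[of k] by (simp add: ac_simps)
    qed
    then have "summable \<alpha>"
      by (rule summable_comparison_test_ev[OF _ summable_mult[OF sum]])
    then have "(\<lambda>n. \<Sum>k<n. \<alpha> k) \<longlonglongrightarrow> suminf \<alpha>" by (rule summable_LIMSEQ)
    then show False
      using div not_tendsto_and_filterlim_at_infinity[of sequentially]
      by (meson filterlim_at_top_imp_at_infinity sequentially_bot)
  qed
  ultimately show ?thesis using a by simp
qed

text \<open>\<open>u\<close> relaxes towards the vanishing input \<rho> at rates of divergent sum,
  so its initial value is forgotten.\<close>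

lemma contraction_tracking_null:
  fixes u a \<rho> :: "nat \<Rightarrow> real"
  assumes "\<And>k. u k \<ge> 0" "\<And>k. 0 \<le> a k" "\<And>k. a k \<le> 1"
    and step: "\<And>k. u (Suc k) \<le> (1 - a k) * u k + a k * \<rho> k"
    and "\<rho> \<longlonglongrightarrow> 0" and div: "filterlim (\<lambda>n. \<Sum>k<n. a k) at_top sequentially"
  shows "u \<longlonglongrightarrow> 0"
proof (rule LIMSEQ_I)
  fix e :: real assume e: "e > 0"
  \<comment> \<open>Once \<rho> is below \<open>e / 2\<close>, the excess of \<open>u\<close> over
    that level obeys the recursion without input, and its decrements dominate
    \<open>a k * t k\<close>.\<close>
  define t where "t k = max (u k - e / 2) 0" for k
  have "eventually (\<lambda>k. \<rho> k < e / 2) sequentially"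
    using order_tendstoD(2)[OF assms(5), of "e / 2"] e by simp
  then obtain N where N: "\<And>k. k \<ge> N \<Longrightarrow> \<rho> k < e / 2" by (auto simp: eventually_sequentially)
  have t_step: "t (Suc k) \<le> t k - a k * t k" if "N \<le> k" for k
  proof -
    have "a k * \<rho> k \<le> a k * (e / 2)" using N[OF that] assms(2) by (intro mult_left_mono) auto
    moreover have "(1 - a k) * (u k - e / 2) = (1 - a k) * u k - e / 2 + a k * (e / 2)"
      by (simp add: field_simps)
    ultimately have "u (Suc k) - e / 2 \<le> (1 - a k) * (u k - e / 2)"
      using step[of k] by linarith
    also have "\<dots> \<le> (1 - a k) * t k"
      using assms(3) by (intro mult_left_mono) (auto simp: t_def)
    finally have "u (Suc k) - e / 2 \<le> (1 - a k) * t k" .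
    moreover have "0 \<le> (1 - a k) * t k" using assms(3) by (simp add: t_def)
    ultimately show ?thesis by (simp add: t_def algebra_simps)
  qed
  have t_nonneg: "0 \<le> t k" for k by (simp add: t_def)
  have "t (Suc k) \<le> t k + 0" if "N \<le> k" for k
    using t_step[OF that] mult_nonneg_nonneg[OF assms(2)[of k] t_nonneg[of k]] by linarith
  then have conv: "convergent t"
    using convergent_if_summable_increments[of N t "\<lambda>_. 0" 0] t_nonneg by simp
  then obtain T where "t \<longlonglongrightarrow> T" by (auto simp: convergent_def)
  then have "summable (\<lambda>k. t k - t (Suc k))" by (rule telescope_summable')
  moreover have "eventually (\<lambda>k. norm (a k * t k) \<le> t k - t (Suc k)) sequentially"
    using eventually_ge_at_top[of N]
    by eventually_elim (use t_step assms(2) t_nonneg in \<open>force simp: abs_mult\<close>)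
  ultimately have "summable (\<lambda>k. a k * t k)" by (rule summable_comparison_test_ev[rotated])
  then have "t \<longlonglongrightarrow> 0" using summable_weighted_imp_null[OF conv t_nonneg assms(2) _ div] by blast
  then have "eventually (\<lambda>k. t k < e / 2) sequentially" using e by (intro order_tendstoD(2)) auto
  then have "eventually (\<lambda>k. norm (u k - 0) < e) sequentially"
  proof eventually_elim
    case (elim k)
    then have "u k - e / 2 < e / 2" by (simp only: t_def max_less_iff_conj)
    then show ?case using assms(1)[of k] by simp
  qed
  then show "\<exists>no. \<forall>n\<ge>no. norm (u n - 0) < e" by (simp add: eventually_sequentially)
qed

text \<open>Keeps only the variational inequality of a proximal map, with a real-valued
  \<open>r\<close> on the domain \<open>D\<close>. It is instantiated both by \<open>\<phi>\<close>
  and by its restriction to the hull of a path.\<close>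

locale prox_map =
  fixes D :: "'a::real_inner set" and P :: "'a \<Rightarrow> 'a" and r :: "'a \<Rightarrow> real" and lam :: real
  assumes lam: "lam > 0"
    and P_in: "P y \<in> D"
    and P_var: "u \<in> D \<Longrightarrow> r (P y) + (y - P y) \<bullet> (u - P y) / lam \<le> r u"
begin

text \<open>Adding the variational inequality at \<open>y\<close> tested with \<open>P y'\<close> to
  the one at \<open>y'\<close> tested with \<open>P y\<close> cancels \<open>r\<close>.\<close>

lemma firmly_nonexpansive: "norm (P y' - P y)^2 \<le> (P y' - P y) \<bullet> (y' - y)"
proof -
  have "(y - P y) \<bullet> (P y' - P y) / lam + (y' - P y') \<bullet> (P y - P y') / lam \<le> 0"
    using P_var[OF P_in, of y y'] P_var[OF P_in, of y' y] by simp
  then have "((y - P y) \<bullet> (P y' - P y) + (y' - P y') \<bullet> (P y - P y')) / lam \<le> 0"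
    by (simp add: add_divide_distrib)
  then have "(y - P y) \<bullet> (P y' - P y) + (y' - P y') \<bullet> (P y - P y') \<le> 0"
    using lam by (simp add: divide_le_0_iff)
  then show ?thesis
    unfolding power2_norm_eq_inner by (simp add: inner_diff_left inner_diff_right inner_commute)
qed

lemma nonexpansive: "norm (P y' - P y) \<le> norm (y' - y)"
proof -
  have "norm (P y' - P y) * norm (P y' - P y) \<le> norm (P y' - P y) * norm (y' - y)"
    using firmly_nonexpansive[of y' y] norm_cauchy_schwarz[of "P y' - P y" "y' - y"]
    by (simp add: power2_eq_square)
  then show ?thesis by (cases "P y' = P y") auto
qed

end

text \<open>Smoothness is asked on \<open>D\<close> only. The quadratic term of
  \<open>f_descent\<close> has \<open>K\<close> in place of the sharp \<open>K / 2\<close>, matching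
  the mean value argument of \<open>lipschitz_gradient_descent\<close>.\<close>

locale normal_map = prox_map D P r lam
  for D :: "'a::real_inner set" and P r lam +
  fixes f :: "'a \<Rightarrow> real" and gf :: "'a \<Rightarrow> 'a" and K \<psi>b :: real
  assumes K: "K \<ge> 0"
    and gf_lipschitz: "\<lbrakk>u \<in> D; v \<in> D\<rbrakk> \<Longrightarrow> norm (gf v - gf u) \<le> K * norm (v - u)"
    and f_descent: "\<lbrakk>u \<in> D; v \<in> D\<rbrakk> \<Longrightarrow> f v \<le> f u + gf u \<bullet> (v - u) + K * norm (v - u)^2"
    and lower: "u \<in> D \<Longrightarrow> \<psi>b \<le> f u + r u"
begin

definition F :: "'a \<Rightarrow> 'a" where
  "F y = gf (P y) + (1 / lam) *\<^sub>R (y - P y)"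

definition psi :: "'a \<Rightarrow> real" where
  "psi y = f (P y) + r (P y)"

lemma F_lipschitz: "norm (F y' - F y) \<le> (K + 2 / lam) * norm (y' - y)"
proof -
  have "F y' - F y = (gf (P y') - gf (P y)) + (1 / lam) *\<^sub>R ((y' - y) - (P y' - P y))"
    by (simp add: F_def algebra_simps)
  also have "norm \<dots> \<le> norm (gf (P y') - gf (P y)) + (1 / lam) * norm ((y' - y) - (P y' - P y))"
    using lam norm_triangle_ineq[of "gf (P y') - gf (P y)" "(1 / lam) *\<^sub>R ((y' - y) - (P y' - P y))"]
    by simp
  also have "\<dots> \<le> K * norm (y' - y) + (1 / lam) * (norm (y' - y) + norm (y' - y))"
  proof (intro add_mono mult_left_mono)
    have "norm (gf (P y') - gf (P y)) \<le> K * norm (P y' - P y)" by (rule gf_lipschitz[OF P_in P_in])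
    also have "\<dots> \<le> K * norm (y' - y)" using K nonexpansive by (rule mult_left_mono[rotated])
    finally show "norm (gf (P y') - gf (P y)) \<le> K * norm (y' - y)" .
    show "norm ((y' - y) - (P y' - P y)) \<le> norm (y' - y) + norm (y' - y)"
      using norm_triangle_ineq4[of "y' - y" "P y' - P y"] nonexpansive[of y' y] by linarith
  qed (use lam in auto)
  finally show ?thesis by (simp add: algebra_simps)
qed

text \<open>The variational inequality is used at the new point \<open>y'\<close>. Its subgradient
  \<open>(y' - P y') / lam\<close> is then exchanged for the one at \<open>y\<close> at the price of
  \<open>norm (y' - y)^2 / lam\<close>, which makes \<open>F y\<close> appear.\<close>

lemma psi_diff_le:
  "psi y' - psi y \<le> F y \<bullet> (P y' - P y) + (1 / lam + K) * norm (y' - y)^2"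
proof -
  define \<delta> where "\<delta> = P y' - P y"
  have \<delta>: "norm \<delta> \<le> norm (y' - y)" unfolding \<delta>_def by (rule nonexpansive)
  have "r (P y') - (y' - P y') \<bullet> \<delta> / lam \<le> r (P y)"
    using P_var[OF P_in, of y' y] unfolding \<delta>_def
    by (simp add: inner_diff_right diff_divide_distrib algebra_simps)
  moreover have "f (P y') \<le> f (P y) + gf (P y) \<bullet> \<delta> + K * norm \<delta>^2"
    unfolding \<delta>_def by (rule f_descent[OF P_in P_in])
  moreover have "K * norm \<delta>^2 \<le> K * norm (y' - y)^2"
    using K \<delta> by (intro mult_left_mono power_mono) auto
  moreover have "(y' - P y') \<bullet> \<delta> / lam \<le> (y - P y) \<bullet> \<delta> / lam + norm (y' - y)^2 / lam"
  proof -
    have "y' - P y' = (y - P y) + (y' - y) - \<delta>" by (simp add: \<delta>_def)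
    then have "(y' - P y') \<bullet> \<delta> = (y - P y) \<bullet> \<delta> + (y' - y) \<bullet> \<delta> - \<delta> \<bullet> \<delta>"
      by (simp only: inner_diff_left inner_add_left)
    also have "\<dots> \<le> (y - P y) \<bullet> \<delta> + norm (y' - y)^2"
      using norm_cauchy_schwarz[of "y' - y" \<delta>] mult_left_mono[OF \<delta> norm_ge_zero[of "y' - y"]]
        inner_ge_zero[of \<delta>] unfolding power2_eq_square by linarith
    finally show ?thesis using lam by (simp add: divide_right_mono flip: add_divide_distrib)
  qed
  ultimately have "psi y' - psi y
      \<le> gf (P y) \<bullet> \<delta> + (y - P y) \<bullet> \<delta> / lam + (norm (y' - y)^2 / lam + K * norm (y' - y)^2)"
    unfolding psi_def by linarith
  also have "\<dots> = F y \<bullet> \<delta> + (1 / lam + K) * norm (y' - y)^2"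
    by (simp add: F_def inner_add_left distrib_right)
  finally show ?thesis by (simp add: \<delta>_def)
qed

text \<open>The denominator provides the two bounds used in \<open>merit_step\<close>: the summand 2
  gives \<open>\<tau> \<le> 1 / 2\<close>, the other one
  \<open>\<tau> * (lam * K)^2 \<le> 1 / 4\<close>.\<close>

definition \<tau> :: real where "\<tau> = 1 / (2 + 4 * (lam * K)^2)"

definition merit :: "'a \<Rightarrow> real" where
  "merit y = psi y + \<tau> * lam / 2 * norm (F y)^2"

text \<open>Collects the coefficients of \<open>norm (y' - y)^2\<close>: \<open>1 / lam + K\<close>
  from \<open>psi_diff_le\<close>, the rest from the squared increment of \<open>F\<close>, with
  \<tau> bounded by one.\<close>

definition merit_curv :: real where
  "merit_curv = 1 / lam + K + lam / 2 * (K + 2 / lam)^2"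

lemma \<tau>_pos: "0 < \<tau>" and \<tau>_le: "\<tau> \<le> 1 / 2" and \<tau>_lam_K: "\<tau> * (lam * K)^2 \<le> 1 / 4"
proof -
  have pos: "2 + 4 * (lam * K)^2 > 0" by (intro add_pos_nonneg) auto
  then show "0 < \<tau>" by (simp add: \<tau>_def)
  show "\<tau> \<le> 1 / 2" using pos by (simp add: \<tau>_def field_simps)
  show "\<tau> * (lam * K)^2 \<le> 1 / 4" using pos by (simp add: \<tau>_def field_simps)
qed

lemma merit_curv_pos: "0 < merit_curv"
  using lam K by (simp add: merit_curv_def add_pos_nonneg)

text \<open>The cross term \<open>F y \<bullet> (P y' - P y)\<close> is controlled by firm nonexpansiveness, which along the
  step direction gives it the sign of \<open>- norm (P y' - P y)^2 / \<alpha>\<close>; the weight \<open>\<tau>\<close> is small enough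
  for this to absorb the change of \<open>gf\<close>.\<close>

lemma merit_step:
  assumes \<alpha>: "0 < \<alpha>" "2 * merit_curv * \<alpha> \<le> \<tau> / 4"
    and y': "y' = y - \<alpha> *\<^sub>R (F y + \<epsilon>)"
  shows "merit y' \<le> merit y - \<tau> / 4 * (\<alpha> * norm (F y)^2) + 2 * (\<alpha> * norm \<epsilon>^2)"
proof -
  define \<delta> where "\<delta> = P y' - P y"
  define \<Delta> where "\<Delta> = y' - y"
  define a where "a = norm (F y)"
  define n where "n = norm \<epsilon>"
  define d where "d = norm \<delta>"
  define G where "G = gf (P y') - gf (P y)"
  have nn: "0 \<le> a" "0 \<le> n" "0 \<le> d" by (simp_all add: a_def n_def d_def)
  have \<Delta>: "\<Delta> = - \<alpha> *\<^sub>R (F y + \<epsilon>)" by (simp add: \<Delta>_def y')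
  have psi: "psi y' - psi y \<le> F y \<bullet> \<delta> + (1 / lam + K) * norm \<Delta>^2"
    unfolding \<delta>_def \<Delta>_def by (rule psi_diff_le)
  have F': "F y' = F y + (F y' - F y)" by simp
  have "norm (F y')^2 = a^2 + 2 * (F y \<bullet> (F y' - F y)) + norm (F y' - F y)^2"
    unfolding a_def by (subst F', simp only: power2_norm_eq_inner inner_add_left inner_add_right)
      (simp add: inner_commute)
  moreover have "norm (F y' - F y)^2 \<le> (K + 2 / lam)^2 * norm \<Delta>^2"
    using power_mono[OF F_lipschitz[of y' y], of 2] by (simp add: \<Delta>_def power_mult_distrib)
  ultimately have "lam / 2 * norm (F y')^2
      \<le> lam / 2 * (a^2 + 2 * (F y \<bullet> (F y' - F y)) + (K + 2 / lam)^2 * norm \<Delta>^2)"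
    using lam by (intro mult_left_mono) auto
  \<comment> \<open>The part \<open>(\<Delta> - \<delta>) / lam\<close> of \<open>F y' - F y\<close>
    loses its factor after scaling by \<open>lam\<close>; the change of \<open>gf\<close> is bounded
    by \<open>K\<close>.\<close>
  moreover have "lam * (F y \<bullet> (F y' - F y)) \<le> lam * K * a * d + F y \<bullet> \<Delta> - F y \<bullet> \<delta>"
  proof -
    have "F y' - F y = G + (1 / lam) *\<^sub>R (\<Delta> - \<delta>)"
      by (simp add: F_def G_def \<Delta>_def \<delta>_def algebra_simps)
    then have "F y \<bullet> (F y' - F y) = F y \<bullet> G + (1 / lam) * (F y \<bullet> \<Delta> - F y \<bullet> \<delta>)"
      by (simp only: inner_add_right inner_diff_right inner_scaleR_right)
    then have "lam * (F y \<bullet> (F y' - F y)) = lam * (F y \<bullet> G) + (F y \<bullet> \<Delta> - F y \<bullet> \<delta>)"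
      using lam by (simp only: distrib_left) simp
    moreover have "F y \<bullet> G \<le> a * (K * d)"
    proof -
      have "F y \<bullet> G \<le> a * norm G" unfolding a_def by (rule norm_cauchy_schwarz)
      also have "\<dots> \<le> a * (K * d)"
        using nn gf_lipschitz[OF P_in P_in] unfolding G_def d_def \<delta>_def by (intro mult_left_mono) auto
      finally show ?thesis .
    qed
    then have "lam * (F y \<bullet> G) \<le> lam * (a * (K * d))" using lam by simp
    ultimately show ?thesis by (simp add: ac_simps)
  qed
  ultimately have "lam / 2 * norm (F y')^2 - lam / 2 * a^2
      \<le> (lam * K * a * d + F y \<bullet> \<Delta> - F y \<bullet> \<delta>) + lam / 2 * (K + 2 / lam)^2 * norm \<Delta>^2"
    by (simp add: algebra_simps)
  then have "\<tau> * (lam / 2 * norm (F y')^2 - lam / 2 * a^2)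
      \<le> \<tau> * ((lam * K * a * d + F y \<bullet> \<Delta> - F y \<bullet> \<delta>) + lam / 2 * (K + 2 / lam)^2 * norm \<Delta>^2)"
    using \<tau>_pos by (intro mult_left_mono) auto
  moreover have "\<tau> * (lam / 2 * (K + 2 / lam)^2 * norm \<Delta>^2) \<le> 1 * (lam / 2 * (K + 2 / lam)^2 * norm \<Delta>^2)"
    using \<tau>_le lam by (intro mult_right_mono) auto
  \<comment> \<open>The squared norm contributes \<open>- \<tau> * (F y \<bullet> \<delta>)\<close>,
    so this product from \<open>psi_diff_le\<close> keeps the weight \<open>1 - \<tau>\<close>. The
    four summands are now bounded one by one.\<close>
  ultimately have "merit y' - merit y
      \<le> (1 - \<tau>) * (F y \<bullet> \<delta>) + \<tau> * (lam * K * a * d) + \<tau> * (F y \<bullet> \<Delta>) + merit_curv * norm \<Delta>^2"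
    using psi unfolding merit_def merit_curv_def a_def by (simp add: algebra_simps)
  \<comment> \<open>Firm nonexpansiveness gives \<open>- d^2 / \<alpha>\<close>. Half of it pays for
    the error by Young's inequality, and \<open>1 - \<tau> \<ge> 1 / 2\<close> keeps half of the
    rest.\<close>
  moreover have "(1 - \<tau>) * (F y \<bullet> \<delta>) \<le> - (d^2 / (4 * \<alpha>)) + \<alpha> * n^2 / 2"
  proof -
    have "d^2 \<le> \<delta> \<bullet> \<Delta>" unfolding d_def \<delta>_def \<Delta>_def by (rule firmly_nonexpansive)
    also have "\<dots> = - \<alpha> * (F y \<bullet> \<delta> + \<epsilon> \<bullet> \<delta>)"
      by (simp add: \<Delta> inner_add_right inner_commute)
    finally have "F y \<bullet> \<delta> \<le> - (d^2 / \<alpha>) + - (\<epsilon> \<bullet> \<delta>)" using \<alpha> by (simp add: field_simps)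
    also have "- (\<epsilon> \<bullet> \<delta>) \<le> n * d"
      using norm_cauchy_schwarz[of "- \<epsilon>" \<delta>] by (simp add: n_def d_def)
    also have "n * d \<le> d^2 / (2 * \<alpha>) + \<alpha> * n^2 / 2"
    proof -
      have "0 \<le> (d - \<alpha> * n)^2 / (2 * \<alpha>)" using \<alpha> by simp
      also have "\<dots> = d^2 / (2 * \<alpha>) + \<alpha> * n^2 / 2 - n * d"
        using \<alpha> by (simp add: power2_eq_square field_simps)
      finally show ?thesis by simp
    qed
    also have "- (d^2 / \<alpha>) + (d^2 / (2 * \<alpha>) + \<alpha> * n^2 / 2) = - (d^2 / (2 * \<alpha>)) + \<alpha> * n^2 / 2"
      using \<alpha> by (simp add: field_simps)
    finally have "F y \<bullet> \<delta> \<le> - (d^2 / (2 * \<alpha>)) + \<alpha> * n^2 / 2" by simp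
    then have "(1 - \<tau>) * (F y \<bullet> \<delta>) \<le> (1 - \<tau>) * (- (d^2 / (2 * \<alpha>)) + \<alpha> * n^2 / 2)"
      using \<tau>_le by (intro mult_left_mono) auto
    also have "\<dots> = - ((1 - \<tau>) * (d^2 / (2 * \<alpha>))) + (1 - \<tau>) * (\<alpha> * n^2 / 2)"
      by (simp add: algebra_simps)
    also have "\<dots> \<le> - (1 / 2 * (d^2 / (2 * \<alpha>))) + 1 * (\<alpha> * n^2 / 2)"
      using \<tau>_pos \<tau>_le \<alpha> by (intro add_mono le_imp_neg_le mult_right_mono) auto
    finally show ?thesis by simp
  qed
  \<comment> \<open>Young's inequality, weighted so that by \<open>\<tau>_lam_K\<close> the
    \<open>d^2\<close> term is exactly what the previous gain cancels.\<close>
  moreover have "\<tau> * (lam * K * a * d) \<le> \<tau> * (\<alpha> * a^2) / 4 + d^2 / (4 * \<alpha>)"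
  proof -
    have "0 \<le> (\<alpha> * a / 2 - lam * K * d)^2 / \<alpha>" using \<alpha> by simp
    also have "\<dots> = \<alpha> * a^2 / 4 + (lam * K)^2 * (d^2 / \<alpha>) - lam * K * a * d"
      using \<alpha> by (simp add: power2_eq_square field_simps)
    finally have "\<tau> * (lam * K * a * d) \<le> \<tau> * (\<alpha> * a^2 / 4 + (lam * K)^2 * (d^2 / \<alpha>))"
      using \<tau>_pos by (intro mult_left_mono) auto
    also have "\<dots> = \<tau> * (\<alpha> * a^2) / 4 + (\<tau> * (lam * K)^2) * (d^2 / \<alpha>)"
      by (simp add: algebra_simps)
    also have "\<dots> \<le> \<tau> * (\<alpha> * a^2) / 4 + 1 / 4 * (d^2 / \<alpha>)"
      using \<tau>_lam_K \<alpha> by (intro add_left_mono mult_right_mono) auto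
    finally show ?thesis by simp
  qed
  moreover have "\<tau> * (F y \<bullet> \<Delta>) \<le> - (\<tau> * (\<alpha> * a^2)) + \<tau> * (\<alpha> * a^2) / 4 + \<alpha> * n^2 / 2"
  proof -
    have "F y \<bullet> \<Delta> = - \<alpha> * a^2 + \<alpha> * (- (F y \<bullet> \<epsilon>))"
      by (simp add: \<Delta> a_def power2_norm_eq_inner inner_add_right algebra_simps)
    also have "\<dots> \<le> - \<alpha> * a^2 + \<alpha> * (a * n)"
      using norm_cauchy_schwarz[of "F y" "- \<epsilon>"] \<alpha>
      by (intro add_left_mono mult_left_mono) (auto simp: a_def n_def)
    also have "a * n \<le> a^2 / 4 + n^2"
      using zero_le_power2[of "a / 2 - n"] by (simp add: power2_eq_square algebra_simps)
    finally have "F y \<bullet> \<Delta> \<le> - \<alpha> * a^2 + \<alpha> * (a^2 / 4 + n^2)" using \<alpha> by simp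
    then have "\<tau> * (F y \<bullet> \<Delta>) \<le> \<tau> * (- \<alpha> * a^2 + \<alpha> * (a^2 / 4 + n^2))"
      using \<tau>_pos by (intro mult_left_mono) auto
    moreover have "\<tau> * (\<alpha> * n^2) \<le> 1 / 2 * (\<alpha> * n^2)"
      using \<tau>_le \<alpha> by (intro mult_right_mono) auto
    ultimately show ?thesis by (simp add: algebra_simps)
  qed
  \<comment> \<open>The step size condition turns a term quadratic in \<alpha> into a small linear
    one.\<close>
  moreover have "merit_curv * norm \<Delta>^2 \<le> \<tau> / 4 * (\<alpha> * a^2) + \<alpha> * n^2"
  proof -
    have "norm \<Delta> \<le> \<alpha> * (a + n)"
      using norm_triangle_ineq[of "F y" \<epsilon>] \<alpha> by (simp add: \<Delta> a_def n_def)
    then have "norm \<Delta>^2 \<le> (\<alpha> * (a + n))^2" by (intro power_mono) auto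
    also have "\<dots> = \<alpha>^2 * (a + n)^2" by (simp add: power_mult_distrib)
    also have "\<dots> \<le> \<alpha>^2 * (2 * (a^2 + n^2))"
      using sum_squares_bound[of a n] by (intro mult_left_mono) (auto simp: power2_sum)
    finally have "merit_curv * norm \<Delta>^2 \<le> merit_curv * (\<alpha>^2 * (2 * (a^2 + n^2)))"
      using merit_curv_pos by (intro mult_left_mono) auto
    also have "\<dots> = (2 * merit_curv * \<alpha>) * (\<alpha> * (a^2 + n^2))"
      by (simp add: power2_eq_square algebra_simps)
    also have "\<dots> \<le> \<tau> / 4 * (\<alpha> * (a^2 + n^2))"
      using \<alpha> by (intro mult_right_mono) auto
    also have "\<dots> = \<tau> / 4 * (\<alpha> * a^2) + \<tau> / 4 * (\<alpha> * n^2)" by (simp add: algebra_simps)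
    also have "\<tau> / 4 * (\<alpha> * n^2) \<le> 1 * (\<alpha> * n^2)"
      using \<tau>_le \<alpha> by (intro mult_right_mono) auto
    finally show ?thesis by simp
  qed
  \<comment> \<open>Balance: the \<open>d^2\<close> terms cancel, \<open>\<alpha> * a^2\<close> has
    the coefficient \<open>\<tau>/4 - \<tau> + \<tau>/4 + \<tau>/4 = - \<tau>/4\<close>, and
    \<open>\<alpha> * n^2\<close> has \<open>1/2 + 1/2 + 1 = 2\<close>.\<close>
  ultimately show ?thesis unfolding a_def n_def by (simp add: algebra_simps)
qed

text \<open>Smallness is asked of the filtered errors \<open>w\<close> alone, which admits errors
  \<open>e\<close> that do not tend to zero along the path.\<close>

lemma normal_map_iteration_converges:
  fixes z w e :: "nat \<Rightarrow> 'a" and \<alpha> a :: "nat \<Rightarrow> real"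
  assumes \<alpha>: "\<And>k. 0 < \<alpha> k" "\<alpha> \<longlonglongrightarrow> 0" "filterlim (\<lambda>n. \<Sum>k<n. \<alpha> k) at_top sequentially"
    and z: "\<And>k. z (Suc k) = z k - \<alpha> k *\<^sub>R (F (z k) + e k)"
    and w: "\<And>k. w (Suc k) = (1 - a k) *\<^sub>R w k + \<alpha> k *\<^sub>R e k"
    and a: "\<And>k. 0 \<le> a k" "\<And>k. a k \<le> \<alpha> k"
    and w_null: "w \<longlonglongrightarrow> 0" and w_sum: "summable (\<lambda>k. \<alpha> k * norm (w k)^2)"
  shows "(\<lambda>k. F (z k)) \<longlonglongrightarrow> 0" and "convergent (\<lambda>k. psi (z k))"
proof -
  define y where "y k = z k + w k" for k
  \<comment> \<open>In \<open>y (Suc k)\<close> the errors \<open>e k\<close> coming from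
    \<open>z\<close> and from \<open>w\<close> cancel; what remains besides the step along
    \<open>F (y k)\<close> is this \<epsilon>.\<close>
  define \<epsilon> where "\<epsilon> k = F (z k) - F (y k) + (a k / \<alpha> k) *\<^sub>R w k" for k
  define C where "C = K + 2 / lam"
  have C: "C \<ge> 0" using K lam by (simp add: C_def)
  have y: "y (Suc k) = y k - \<alpha> k *\<^sub>R (F (y k) + \<epsilon> k)" for k
    using \<alpha>(1)[of k] by (simp add: y_def \<epsilon>_def z w algebra_simps)
  have Fzy: "norm (F (z k) - F (y k)) \<le> C * norm (w k)" for k
    using F_lipschitz[of "z k" "y k"] by (simp add: y_def C_def)
  have \<epsilon>: "norm (\<epsilon> k) \<le> (C + 1) * norm (w k)" for k
  proof -
    have "norm (\<epsilon> k) \<le> norm (F (z k) - F (y k)) + (a k / \<alpha> k) * norm (w k)"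
      unfolding \<epsilon>_def using a(1)[of k] \<alpha>(1)[of k]
      by (intro order_trans[OF norm_triangle_ineq]) auto
    also have "\<dots> \<le> C * norm (w k) + 1 * norm (w k)"
      using Fzy a(2)[of k] \<alpha>(1)[of k] by (intro add_mono mult_right_mono) auto
    finally show ?thesis by (simp add: algebra_simps)
  qed
  have \<epsilon>_sum: "summable (\<lambda>k. \<alpha> k * norm (\<epsilon> k)^2)"
  proof (rule summable_comparison_test'[where N = 0])
    show "summable (\<lambda>k. (C + 1)^2 * (\<alpha> k * norm (w k)^2))" using w_sum by (rule summable_mult)
    fix k
    have "\<alpha> k * norm (\<epsilon> k)^2 \<le> \<alpha> k * ((C + 1) * norm (w k))^2"
      using \<epsilon> \<alpha>(1)[of k] by (intro mult_left_mono power_mono) auto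
    then show "norm (\<alpha> k * norm (\<epsilon> k)^2) \<le> (C + 1)^2 * (\<alpha> k * norm (w k)^2)"
      using \<alpha>(1)[of k] by (simp add: power_mult_distrib mult.left_commute)
  qed
  \<comment> \<open>The first threshold is the step size condition of \<open>merit_step\<close>; the
    second, \<alpha> below one, absorbs higher powers of \<alpha> in the growth of
    \<open>norm (F (y k))^2\<close>.\<close>
  have "eventually (\<lambda>k. \<alpha> k < \<tau> / 4 / (2 * merit_curv)) sequentially"
    using order_tendstoD(2)[OF \<alpha>(2)] \<tau>_pos merit_curv_pos by simp
  moreover have "eventually (\<lambda>k. \<alpha> k < 1) sequentially"
    using order_tendstoD(2)[OF \<alpha>(2)] by simp
  ultimately obtain N where N: "\<And>k. N \<le> k \<Longrightarrow> \<alpha> k < \<tau> / 4 / (2 * merit_curv) \<and> \<alpha> k < 1"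
    unfolding eventually_sequentially by (metis (no_types) linear order_trans)
  have step: "merit (y (Suc k)) \<le> merit (y k) - \<tau> / 4 * (\<alpha> k * norm (F (y k))^2)
      + 2 * (\<alpha> k * norm (\<epsilon> k)^2)" if "N \<le> k" for k
    using N[OF that] \<alpha>(1)[of k] merit_curv_pos
    by (intro merit_step[OF _ _ y]) (auto simp: field_simps)
  have nn: "0 \<le> \<tau> / 4 * (\<alpha> k * norm (F (y k))^2)" for k
    using \<tau>_pos \<alpha>(1)[of k] by simp
  have "merit (y (Suc k)) \<le> merit (y k) + 2 * (\<alpha> k * norm (\<epsilon> k)^2)" if "N \<le> k" for k
    using step[OF that] nn[of k] by linarith
  moreover have "\<psi>b \<le> merit (y k)" for k
    using lower[OF P_in] lam \<tau>_pos by (simp add: merit_def psi_def add_increasing2)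
  ultimately have conv: "convergent (\<lambda>k. merit (y k))"
    by (intro convergent_if_summable_increments[of N _ "\<lambda>k. 2 * (\<alpha> k * norm (\<epsilon> k)^2)" \<psi>b]
        summable_mult \<epsilon>_sum)
  then obtain m where m: "(\<lambda>k. merit (y k)) \<longlonglongrightarrow> m" by (auto simp: convergent_def)
  have "summable (\<lambda>k. \<tau> / 4 * (\<alpha> k * norm (F (y k))^2))"
  proof (rule summable_comparison_test'[where N = N])
    show "summable (\<lambda>k. (merit (y k) - merit (y (Suc k))) + 2 * (\<alpha> k * norm (\<epsilon> k)^2))"
      using telescope_summable'[OF m] \<epsilon>_sum by (intro summable_add summable_mult)
    fix k assume "N \<le> k"
    then show "norm (\<tau> / 4 * (\<alpha> k * norm (F (y k))^2))
        \<le> (merit (y k) - merit (y (Suc k))) + 2 * (\<alpha> k * norm (\<epsilon> k)^2)"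
      using step[OF \<open>N \<le> k\<close>] nn[of k] unfolding real_norm_def by linarith
  qed
  then have F_sum: "summable (\<lambda>k. \<alpha> k * norm (F (y k))^2)"
    using \<tau>_pos by (simp add: summable_cmult_iff)
  \<comment> \<open>Weighted summability alone would permit oscillation; a summable upper bound on
    the increments rules it out.\<close>
  have "convergent (\<lambda>k. norm (F (y k))^2)"
  proof (rule convergent_if_summable_increments)
    show "summable (\<lambda>k. (3 * C + 2 * C^2) * (\<alpha> k * norm (F (y k))^2 + \<alpha> k * norm (\<epsilon> k)^2))"
      using F_sum \<epsilon>_sum by (intro summable_mult summable_add)
    fix k assume "N \<le> k"
    let ?b = "norm (F (y k))" and ?n = "norm (\<epsilon> k)"
    have \<alpha>1: "0 < \<alpha> k" "\<alpha> k \<le> 1" using \<alpha>(1)[of k] N[OF \<open>N \<le> k\<close>] by auto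
    have "norm (F (y (Suc k)) - F (y k)) \<le> C * norm (y (Suc k) - y k)"
      using F_lipschitz by (simp add: C_def)
    also have "norm (y (Suc k) - y k) \<le> \<alpha> k * (?b + ?n)"
      using \<alpha>(1)[of k] norm_triangle_ineq[of "F (y k)" "\<epsilon> k"] by (simp add: y)
    finally have "norm (F (y (Suc k)) - F (y k)) \<le> C * (\<alpha> k * (?b + ?n))"
      using C by (simp add: mult_left_mono)
    then have "norm (F (y (Suc k))) \<le> ?b + C * (\<alpha> k * (?b + ?n))"
      using norm_triangle_sub[of "F (y (Suc k))" "F (y k)"] by linarith
    then have "norm (F (y (Suc k)))^2 \<le> (?b + C * (\<alpha> k * (?b + ?n)))^2"
      by (intro power_mono) auto
    also have "\<dots> = ?b^2 + \<alpha> k * (2 * C * (?b * (?b + ?n)) + \<alpha> k * (C^2 * (?b + ?n)^2))"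
      by (simp add: power2_eq_square algebra_simps)
    also have "\<alpha> k * (2 * C * (?b * (?b + ?n)) + \<alpha> k * (C^2 * (?b + ?n)^2))
        \<le> \<alpha> k * (C * (3 * (?b^2 + ?n^2)) + 1 * (C^2 * (2 * (?b^2 + ?n^2))))"
    proof -
      have "2 * (?b * (?b + ?n)) \<le> 3 * (?b^2 + ?n^2)" "(?b + ?n)^2 \<le> 2 * (?b^2 + ?n^2)"
        using sum_squares_bound[of ?b ?n] zero_le_power2[of ?n]
        by (simp_all add: power2_eq_square algebra_simps) (smt (verit) zero_le_square)
      note sq = this
      from sq(1) have "C * (2 * (?b * (?b + ?n))) \<le> C * (3 * (?b^2 + ?n^2))"
        using C by (rule mult_left_mono)
      moreover have "\<alpha> k * (C^2 * (?b + ?n)^2) \<le> 1 * (C^2 * (2 * (?b^2 + ?n^2)))"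
        using sq(2) \<alpha>1 by (intro mult_mono) auto
      ultimately have "2 * C * (?b * (?b + ?n)) + \<alpha> k * (C^2 * (?b + ?n)^2)
          \<le> C * (3 * (?b^2 + ?n^2)) + 1 * (C^2 * (2 * (?b^2 + ?n^2)))"
        by (intro add_mono) (simp_all only: ac_simps)
      then show ?thesis using \<alpha>1 by (intro mult_left_mono) auto
    qed
    finally show "norm (F (y (Suc k)))^2
        \<le> ?b^2 + (3 * C + 2 * C^2) * (\<alpha> k * ?b^2 + \<alpha> k * ?n^2)"
      by (simp add: algebra_simps)
  qed (rule zero_le_power2)
  then have "(\<lambda>k. norm (F (y k))^2) \<longlonglongrightarrow> 0"
    using \<alpha>(1) by (intro summable_weighted_imp_null[OF _ _ _ F_sum \<alpha>(3)]) (auto intro: less_imp_le)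
  then have nF: "(\<lambda>k. norm (F (y k))) \<longlonglongrightarrow> 0"
    using tendsto_real_sqrt by fastforce
  then have Fy: "(\<lambda>k. F (y k)) \<longlonglongrightarrow> 0" by (rule tendsto_norm_zero_cancel)
  have nw: "(\<lambda>k. norm (w k)) \<longlonglongrightarrow> 0" using w_null by (rule tendsto_norm_zero)
  \<comment> \<open>The limits for \<open>y\<close> are carried back to the iterates
    \<open>z\<close>, at distance \<open>norm (w k)\<close>.\<close>
  have "(\<lambda>k. F (z k) - F (y k)) \<longlonglongrightarrow> 0"
    by (rule Lim_null_comparison[OF _ tendsto_mult_right_zero[OF nw, of C]]) (use Fzy in auto)
  from tendsto_add[OF this Fy] show Fz: "(\<lambda>k. F (z k)) \<longlonglongrightarrow> 0" by simp
  have "(\<lambda>k. merit (y k) - \<tau> * lam / 2 * norm (F (y k))^2) \<longlonglongrightarrow> m - \<tau> * lam / 2 * 0^2"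
    by (intro tendsto_intros m nF)
  then have psi_y: "(\<lambda>k. psi (y k)) \<longlonglongrightarrow> m" by (simp add: merit_def)
  let ?b = "\<lambda>k. (norm (F (y k)) + norm (F (z k))) * norm (w k) + (1 / lam + K) * norm (w k)^2"
  have "(\<lambda>k. psi (z k) - psi (y k)) \<longlonglongrightarrow> 0"
  proof (rule Lim_null_comparison)
    have "?b \<longlonglongrightarrow> (0 + 0) * 0 + (1 / lam + K) * 0^2"
      by (intro tendsto_intros nF nw tendsto_norm_zero Fz)
    then show "?b \<longlonglongrightarrow> 0" by simp
    \<comment> \<open>\<open>psi_diff_le\<close> is one-sided and is applied in both directions,
      hence the two norms of \<open>F\<close> in \<open>?b\<close>.\<close>
    have bnd: "psi v - psi u \<le> norm (F u) * norm (v - u) + (1 / lam + K) * norm (v - u)^2" for u v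
    proof -
      have "F u \<bullet> (P v - P u) \<le> norm (F u) * norm (P v - P u)" by (rule norm_cauchy_schwarz)
      also have "\<dots> \<le> norm (F u) * norm (v - u)" using nonexpansive by (intro mult_left_mono) auto
      finally show ?thesis using psi_diff_le[of v u] by linarith
    qed
    have wyz: "norm (y k - z k) = norm (w k)" for k by (simp add: y_def)
    have "norm (psi (z k) - psi (y k)) \<le> ?b k" for k
      using bnd[of "z k" "y k", unfolded norm_minus_commute[of "z k" "y k"] wyz]
        bnd[of "y k" "z k", unfolded wyz]
        mult_nonneg_nonneg[OF norm_ge_zero norm_ge_zero, of "F (y k)" "w k"]
        mult_nonneg_nonneg[OF norm_ge_zero norm_ge_zero, of "F (z k)" "w k"]
      unfolding real_norm_def distrib_right by linarith
    then show "\<forall>\<^sub>F k in sequentially. norm (psi (z k) - psi (y k)) \<le> ?b k" by simp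
  qed
  from tendsto_add[OF this psi_y] show "convergent (\<lambda>k. psi (z k))"
    by (auto simp: convergent_def)
qed

end

subsection \<open>Square-integrable martingale differences\<close>

primrec running_max :: "(nat \<Rightarrow> real) \<Rightarrow> nat \<Rightarrow> real" where
  "running_max s 0 = s 0"
| "running_max s (Suc n) = max (running_max s n) (s (Suc n))"

lemma le_running_max: "j \<le> n \<Longrightarrow> s j \<le> running_max s n"
  by (induction n) (auto simp: le_Suc_eq le_max_iff_disj)

lemma running_max_mono: "m \<le> n \<Longrightarrow> running_max s m \<le> running_max s n"
  by (induction n) (auto simp: le_Suc_eq le_max_iff_disj)

lemma running_max_nonneg: "s 0 \<ge> 0 \<Longrightarrow> running_max s n \<ge> 0"
  using le_running_max[of 0 n s] by simp

text \<open>A pathwise form of Doob's \<open>L\<^sup>2\<close> maximal inequality: the last sum is a discrete stochastic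
  integral, so it has nonnegative expectation when \<open>s\<close> is a submartingale.\<close>

lemma running_max_square_le:
  "(running_max s n)^2 \<le> 4 * (s n)^2 - 4 * (\<Sum>k<n. running_max s k * (s (Suc k) - s k))"
proof -
  have "(\<Sum>k<n. running_max s k * (s (Suc k) - s k)) \<le> running_max s n * s n - (running_max s n)^2 / 2"
  proof (induction n)
    case 0
    show ?case by (simp add: power2_eq_square)
  next
    case (Suc n)
    let ?R = "running_max s n" and ?t = "s (Suc n)"
    have "(\<Sum>k<Suc n. running_max s k * (s (Suc k) - s k)) \<le> ?R * ?t - ?R^2 / 2"
      using Suc by (simp add: algebra_simps)
    \<comment> \<open>Equality unless \<open>?t\<close> is a new maximum; then the gain is
      \<open>(?R - ?t)^2 / 2\<close>.\<close>
    also have "\<dots> \<le> max ?R ?t * ?t - (max ?R ?t)^2 / 2"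
      using zero_le_power2[of "?R - ?t"] by (auto simp: max_def power2_eq_square algebra_simps)
    finally show ?case by simp
  qed
  \<comment> \<open>Young's inequality, weighted to leave a quarter of the squared maximum after
    absorption.\<close>
  moreover have "running_max s n * s n \<le> (running_max s n)^2 / 4 + (s n)^2"
    using zero_le_power2[of "running_max s n / 2 - s n"] by (simp add: power2_eq_square algebra_simps)
  ultimately show ?thesis by linarith
qed

lemma AE_summable_of_summable_integral:
  fixes h :: "nat \<Rightarrow> 'w \<Rightarrow> real"
  assumes int: "\<And>k. integrable M (h k)" and nn: "\<And>k \<omega>. 0 \<le> h k \<omega>"
    and sum: "summable (\<lambda>k. \<integral>\<omega>. h k \<omega> \<partial>M)"
  shows "AE \<omega> in M. summable (\<lambda>k. h k \<omega>)"
proof -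
  have meas: "h k \<in> borel_measurable M" for k using int by blast
  have "(\<integral>\<^sup>+\<omega>. (\<Sum>k. ennreal (h k \<omega>)) \<partial>M) = (\<Sum>k. \<integral>\<^sup>+\<omega>. ennreal (h k \<omega>) \<partial>M)"
    using meas by (intro nn_integral_suminf) simp
  also have "\<dots> = (\<Sum>k. ennreal (\<integral>\<omega>. h k \<omega> \<partial>M))"
    using nn_integral_eq_integral[OF int] nn by simp
  also have "\<dots> = ennreal (\<Sum>k. \<integral>\<omega>. h k \<omega> \<partial>M)"
    using sum nn by (intro suminf_ennreal2) (auto intro: integral_nonneg_AE)
  finally have "(\<integral>\<^sup>+\<omega>. (\<Sum>k. ennreal (h k \<omega>)) \<partial>M) \<noteq> \<infinity>" by simp
  then have "AE \<omega> in M. (\<Sum>k. ennreal (h k \<omega>)) \<noteq> \<infinity>"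
    using meas by (intro nn_integral_PInf_AE) auto
  then show ?thesis
    by eventually_elim (auto intro: summable_suminf_not_top nn)
qed

lemma integrable_inner_of_square_integrable:
  fixes u v :: "'w \<Rightarrow> 'a::euclidean_space"
  assumes [measurable]: "u \<in> borel_measurable M" "v \<in> borel_measurable M"
    and "integrable M (\<lambda>\<omega>. norm (u \<omega>)^2)" "integrable M (\<lambda>\<omega>. norm (v \<omega>)^2)"
  shows "integrable M (\<lambda>\<omega>. u \<omega> \<bullet> v \<omega>)"
proof (rule Bochner_Integration.integrable_bound)
  show "integrable M (\<lambda>\<omega>. norm (u \<omega>)^2 + norm (v \<omega>)^2)" using assms by simp
  show "AE \<omega> in M. norm (u \<omega> \<bullet> v \<omega>) \<le> norm (norm (u \<omega>)^2 + norm (v \<omega>)^2)"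
  proof (intro AE_I2)
    fix \<omega>
    have "2 * norm (u \<omega> \<bullet> v \<omega>) \<le> 2 * (norm (u \<omega>) * norm (v \<omega>))"
      using Cauchy_Schwarz_ineq2[of "u \<omega>" "v \<omega>"] by simp
    also have "\<dots> \<le> norm (u \<omega>)^2 + norm (v \<omega>)^2" 
      using sum_squares_bound[of "norm (u \<omega>)" "norm (v \<omega>)"] by simp
    finally show "norm (u \<omega> \<bullet> v \<omega>) \<le> norm (norm (u \<omega>)^2 + norm (v \<omega>)^2)" by simp
  qed
qed simp

text \<open>\<open>V\<close> can be moved inside the conditional expectation of
  \<open>g - h\<close>, which vanishes. The argument runs by coordinates because
  \<open>real_cond_exp\<close> is scalar.\<close>

lemma cond_exp_centered_orth:
  fixes g h V :: "'w \<Rightarrow> 'a::euclidean_space"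
  assumes "prob_space M" "subalgebra M F" and g: "integrable M g" and h: "h \<in> borel_measurable F"
    and ce: "\<And>b. b \<in> Basis \<Longrightarrow> AE \<omega> in M. real_cond_exp M F (\<lambda>\<omega>. g \<omega> \<bullet> b) \<omega> = h \<omega> \<bullet> b"
    and sq: "integrable M (\<lambda>\<omega>. norm (g \<omega> - h \<omega>)^2)"
    and V: "V \<in> borel_measurable F" and V_sq: "integrable M (\<lambda>\<omega>. norm (V \<omega>)^2)"
  shows "(\<integral>\<omega>. V \<omega> \<bullet> (g \<omega> - h \<omega>) \<partial>M) = 0"
proof -
  interpret prob_space M by fact
  interpret finite_measure_subalgebra M F by unfold_locales fact
  have hM[measurable]: "h \<in> borel_measurable M" and VM[measurable]: "V \<in> borel_measurable M"
    using measurable_from_subalg[OF assms(2)] h V by auto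
  have gM[measurable]: "g \<in> borel_measurable M" using g by simp
  note [measurable] = h V
  have comp: "integrable M (\<lambda>\<omega>. (V \<omega> \<bullet> b) * ((g \<omega> - h \<omega>) \<bullet> b))
      \<and> (\<integral>\<omega>. (V \<omega> \<bullet> b) * ((g \<omega> - h \<omega>) \<bullet> b) \<partial>M) = 0" if b: "b \<in> Basis" for b
  proof -
    have comp_sq: "integrable M (\<lambda>\<omega>. norm (u \<omega> \<bullet> b)^2)"
      if "u \<in> borel_measurable M" "integrable M (\<lambda>\<omega>. norm (u \<omega>)^2)" for u :: "'w \<Rightarrow> 'a"
    proof (rule Bochner_Integration.integrable_bound[OF that(2)])
      show "(\<lambda>\<omega>. norm (u \<omega> \<bullet> b)^2) \<in> borel_measurable M" using that(1) by measurable
      have "norm (u \<omega> \<bullet> b)^2 \<le> norm (u \<omega>)^2" for \<omega>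
        using Basis_le_norm[OF b] by (intro power_mono) auto
      then show "AE \<omega> in M. norm (norm (u \<omega> \<bullet> b)^2) \<le> norm (norm (u \<omega>)^2)" by simp
    qed
    have int: "integrable M (\<lambda>\<omega>. (V \<omega> \<bullet> b) * ((g \<omega> - h \<omega>) \<bullet> b))"
      unfolding inner_real_def[symmetric]
    proof (rule integrable_inner_of_square_integrable)
      show "integrable M (\<lambda>\<omega>. norm (V \<omega> \<bullet> b)^2)" by (rule comp_sq[OF VM V_sq])
      show "integrable M (\<lambda>\<omega>. norm ((g \<omega> - h \<omega>) \<bullet> b)^2)" by (rule comp_sq[OF _ sq]) measurable
    qed measurable
    have gb: "integrable M (\<lambda>\<omega>. g \<omega> \<bullet> b)" using g by simp
    \<comment> \<open>Integrability is inherited from the conditional expectation, which agrees with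
      this coordinate almost everywhere.\<close>
    have hb: "integrable M (\<lambda>\<omega>. h \<omega> \<bullet> b)"
    proof (rule integrable_cong_AE_imp[OF real_cond_exp_int(1)[OF gb]])
      show "(\<lambda>\<omega>. h \<omega> \<bullet> b) \<in> borel_measurable M" by measurable
    qed (rule ce[OF b])
    have "AE \<omega> in M. real_cond_exp M F (\<lambda>\<omega>. g \<omega> \<bullet> b - h \<omega> \<bullet> b) \<omega> = 0"
    proof -
      have "AE \<omega> in M. real_cond_exp M F (\<lambda>\<omega>. h \<omega> \<bullet> b) \<omega> = h \<omega> \<bullet> b"
        by (rule real_cond_exp_F_meas[OF hb]) measurable
      with real_cond_exp_diff[OF gb hb] ce[OF b] show ?thesis by eventually_elim simp
    qed
    then have "AE \<omega> in M. (V \<omega> \<bullet> b) * real_cond_exp M F (\<lambda>\<omega>. (g \<omega> - h \<omega>) \<bullet> b) \<omega> = 0"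
      by eventually_elim (simp add: inner_diff_left)
    then have "(\<integral>\<omega>. (V \<omega> \<bullet> b) * real_cond_exp M F (\<lambda>\<omega>. (g \<omega> - h \<omega>) \<bullet> b) \<omega> \<partial>M) = 0"
      by (rule integral_eq_zero_AE)
    moreover have "(\<integral>\<omega>. (V \<omega> \<bullet> b) * real_cond_exp M F (\<lambda>\<omega>. (g \<omega> - h \<omega>) \<bullet> b) \<omega> \<partial>M)
        = (\<integral>\<omega>. (V \<omega> \<bullet> b) * ((g \<omega> - h \<omega>) \<bullet> b) \<partial>M)"
      by (rule real_cond_exp_intg(2)[OF int]) measurable
    ultimately show ?thesis using int by simp
  qed
  have "(\<integral>\<omega>. V \<omega> \<bullet> (g \<omega> - h \<omega>) \<partial>M) = (\<Sum>b\<in>Basis. \<integral>\<omega>. (V \<omega> \<bullet> b) * ((g \<omega> - h \<omega>) \<bullet> b) \<partial>M)"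
    by (subst euclidean_inner, rule Bochner_Integration.integral_sum) (use comp in blast)
  then show ?thesis using comp by simp
qed

text \<open>Adding the tail \<open>r k\<close> of the series to \<open>w k\<close> turns the noise
  into an input \<open>a k *\<^sub>R r k\<close> with \<open>r\<close> tending to zero, the setting
  of \<open>contraction_tracking_null\<close>.\<close>

lemma contraction_noise_null:
  fixes w d :: "nat \<Rightarrow> 'a::real_normed_vector"
  assumes w: "\<And>k. w (Suc k) = (1 - a k) *\<^sub>R w k + d k" and d: "summable d"
    and a: "\<And>k. 0 \<le> a k" "\<And>k. a k \<le> 1" "filterlim (\<lambda>n. \<Sum>k<n. a k) at_top sequentially"
  shows "w \<longlonglongrightarrow> 0"
proof -
  define r where "r k = suminf d - (\<Sum>i<k. d i)" for k
  have "r \<longlonglongrightarrow> suminf d - suminf d"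
    unfolding r_def by (intro tendsto_intros summable_LIMSEQ d)
  then have r: "r \<longlonglongrightarrow> 0" by simp
  define y where "y k = w k + r k" for k
  have y: "y (Suc k) = (1 - a k) *\<^sub>R y k + a k *\<^sub>R r k" for k
    by (simp add: y_def r_def w algebra_simps)
  have "norm (y (Suc k)) \<le> (1 - a k) * norm (y k) + a k * norm (r k)" for k
    unfolding y by (intro order_trans[OF norm_triangle_ineq]) (use a in auto)
  then have "(\<lambda>k. norm (y k)) \<longlonglongrightarrow> 0"
    by (rule contraction_tracking_null[OF norm_ge_zero a(1,2) _ tendsto_norm_zero[OF r] a(3)])
  then have "y \<longlonglongrightarrow> 0" by (rule tendsto_norm_zero_cancel)
  from tendsto_diff[OF this r] show ?thesis by (simp add: y_def)
qed

text \<open>Martingale differences, with conditional centering recorded as orthogonality to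
  square-integrable vectors known at time \<open>k\<close>.\<close>

locale square_integrable_noise = prob_space M for M :: "'w measure" +
  fixes Fs :: "nat \<Rightarrow> 'w measure" and d :: "nat \<Rightarrow> 'w \<Rightarrow> 'a::euclidean_space" and c :: "nat \<Rightarrow> real"
  assumes filt: "filtration (space M) Fs" and sub: "\<And>k. subalgebra M (Fs k)"
    and d_meas: "\<And>k. d k \<in> borel_measurable (Fs (Suc k))"
    and d_int: "\<And>k. integrable M (\<lambda>\<omega>. norm (d k \<omega>)^2)"
    and d_bound: "\<And>k. (\<integral>\<omega>. norm (d k \<omega>)^2 \<partial>M) \<le> c k"
    and d_orth: "\<And>k V. V \<in> borel_measurable (Fs k) \<Longrightarrow> integrable M (\<lambda>\<omega>. norm (V \<omega>)^2)
                  \<Longrightarrow> (\<integral>\<omega>. V \<omega> \<bullet> d k \<omega> \<partial>M) = 0"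
    and c_sum: "summable c"
begin

lemma measurable_Fs_mono:
  assumes "V \<in> borel_measurable (Fs j)" "j \<le> k"
  shows "V \<in> borel_measurable (Fs k)"
proof (rule measurable_from_subalg[OF _ assms(1)])
  show "subalgebra (Fs k) (Fs j)"
    using filt assms(2) by (simp add: subalgebra_def filtration_def)
qed

lemma measurable_Fs_M: "V \<in> borel_measurable (Fs k) \<Longrightarrow> V \<in> borel_measurable M"
  by (rule measurable_from_subalg[OF sub])

lemma c_nonneg: "0 \<le> c k"
  by (rule order_trans[OF _ d_bound]) (simp add: integral_nonneg_AE)

text \<open>Free rates \<open>a\<close> and a free starting index \<open>m\<close> let one
  computation serve twice: for the filtered noise with \<open>m = 0\<close>, and with zero rates for
  the partial sums started at \<open>m\<close>.\<close>

context
  fixes w :: "nat \<Rightarrow> 'w \<Rightarrow> 'a" and a :: "nat \<Rightarrow> real" and m :: nat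
  assumes w_0: "\<And>\<omega>. w 0 \<omega> = 0"
    and w_Suc: "\<And>k \<omega>. w (Suc k) \<omega> = (1 - a k) *\<^sub>R w k \<omega> + d (m + k) \<omega>"
    and a: "\<And>k. 0 \<le> a k" "\<And>k. a k \<le> 1"
begin

lemma tracker_measurable: "w k \<in> borel_measurable (Fs (m + k))"
proof (induction k)
  case 0
  have "w 0 = (\<lambda>_. 0)" using w_0 by auto
  then show ?case by simp
next
  case (Suc k)
  have [measurable]: "w k \<in> borel_measurable (Fs (Suc (m + k)))"
    using measurable_Fs_mono[OF Suc] by simp
  have [measurable]: "d (m + k) \<in> borel_measurable (Fs (Suc (m + k)))" by (rule d_meas)
  have "w (Suc k) = (\<lambda>\<omega>. (1 - a k) *\<^sub>R w k \<omega> + d (m + k) \<omega>)" using w_Suc by auto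
  then show ?case by simp
qed

text \<open>The cross term has zero expectation because \<open>w k\<close> is known before
  \<open>d (m + k)\<close>, and \<open>(1 - a k)^2 \<le> 1 - a k\<close>.\<close>

lemma tracker_square:
  "integrable M (\<lambda>\<omega>. norm (w k \<omega>)^2) \<and>
   (\<integral>\<omega>. norm (w (Suc k) \<omega>)^2 \<partial>M) \<le> (1 - a k) * (\<integral>\<omega>. norm (w k \<omega>)^2 \<partial>M) + c (m + k)"
proof -
  have expand: "norm (w (Suc k) \<omega>)^2
      = (1 - a k)^2 * norm (w k \<omega>)^2 + 2 * (1 - a k) * (w k \<omega> \<bullet> d (m + k) \<omega>) + norm (d (m + k) \<omega>)^2"
    for k \<omega>
    unfolding w_Suc power2_norm_eq_inner
    by (simp add: inner_add_left inner_add_right inner_commute power2_eq_square algebra_simps)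
  have meas: "w k \<in> borel_measurable M" "d (m + k) \<in> borel_measurable M" for k
    using measurable_Fs_M tracker_measurable d_meas by blast+
  have inner: "integrable M (\<lambda>\<omega>. w k \<omega> \<bullet> d (m + k) \<omega>)" if "integrable M (\<lambda>\<omega>. norm (w k \<omega>)^2)" for k
    using that by (intro integrable_inner_of_square_integrable meas d_int)
  have int: "integrable M (\<lambda>\<omega>. norm (w k \<omega>)^2)" for k
  proof (induction k)
    case 0
    show ?case by (simp add: w_0)
  next
    case (Suc k)
    then show ?case
      unfolding expand by (intro Bochner_Integration.integrable_add integrable_mult_right inner d_int)
  qed
  have "(\<integral>\<omega>. norm (w (Suc k) \<omega>)^2 \<partial>M) = (1 - a k)^2 * (\<integral>\<omega>. norm (w k \<omega>)^2 \<partial>M)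
      + 2 * (1 - a k) * (\<integral>\<omega>. w k \<omega> \<bullet> d (m + k) \<omega> \<partial>M) + (\<integral>\<omega>. norm (d (m + k) \<omega>)^2 \<partial>M)"
    unfolding expand using int[of k] inner[OF int, of k] d_int[of "m + k"] by simp
  also have "(\<integral>\<omega>. w k \<omega> \<bullet> d (m + k) \<omega> \<partial>M) = 0"
    by (intro d_orth tracker_measurable int)
  also have "(1 - a k)^2 * (\<integral>\<omega>. norm (w k \<omega>)^2 \<partial>M) \<le> (1 - a k) * (\<integral>\<omega>. norm (w k \<omega>)^2 \<partial>M)"
    using a[of k] by (intro mult_right_mono) (auto simp: power2_eq_square mult_left_le)
  finally show ?thesis using d_bound[of "m + k"] int by auto
qed

text \<open>Telescopes \<open>tracker_square\<close>. The sum is what matters for the filter, the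
  leading term for zero rates.\<close>

lemma tracker_weighted_sum:
  "(\<integral>\<omega>. norm (w n \<omega>)^2 \<partial>M) + (\<Sum>k<n. a k * (\<integral>\<omega>. norm (w k \<omega>)^2 \<partial>M)) \<le> (\<Sum>k<n. c (m + k))"
proof (induction n)
  case 0
  show ?case by (simp add: w_0)
next
  case (Suc n)
  then show ?case using conjunct2[OF tracker_square[of n]] by (simp add: algebra_simps)
qed

lemma AE_tracker_summable: "AE \<omega> in M. summable (\<lambda>k. a k * norm (w k \<omega>)^2)"
proof (rule AE_summable_of_summable_integral)
  show "integrable M (\<lambda>\<omega>. a k * norm (w k \<omega>)^2)" for k
    using tracker_square by (intro integrable_mult_right) auto
  show "0 \<le> a k * norm (w k \<omega>)^2" for k \<omega> using a by simp
  have "summable (\<lambda>k. a k * (\<integral>\<omega>. norm (w k \<omega>)^2 \<partial>M))"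
  proof (rule summableI_nonneg_bounded)
    show "0 \<le> a k * (\<integral>\<omega>. norm (w k \<omega>)^2 \<partial>M)" for k
      using a by (simp add: integral_nonneg_AE)
    fix n
    have "(\<Sum>k<n. a k * (\<integral>\<omega>. norm (w k \<omega>)^2 \<partial>M)) \<le> (\<Sum>k<n. c (m + k))"
      using tracker_weighted_sum[of n] by (rule order_trans[rotated]) (simp add: integral_nonneg_AE)
    also have "\<dots> \<le> (\<Sum>k. c (m + k))"
      using c_sum c_nonneg by (intro sum_le_suminf) (auto simp: add.commute[of m] summable_iff_shift)
    finally show "(\<Sum>k<n. a k * (\<integral>\<omega>. norm (w k \<omega>)^2 \<partial>M)) \<le> (\<Sum>k. c (m + k))" .
  qed
  then show "summable (\<lambda>k. \<integral>\<omega>. a k * norm (w k \<omega>)^2 \<partial>M)" by simp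
qed

end

definition block :: "nat \<Rightarrow> nat \<Rightarrow> 'w \<Rightarrow> 'a" where
  "block m j \<omega> = (\<Sum>i<j. d (m + i) \<omega>)"

text \<open>The idle factor \<open>(1 - 0)\<close> gives \<open>block\<close> the shape of a tracker
  with zero rates.\<close>

lemma block_0: "block m 0 \<omega> = 0"
  and block_Suc: "block m (Suc j) \<omega> = (1 - 0) *\<^sub>R block m j \<omega> + d (m + j) \<omega>"
  by (simp_all add: block_def)

lemmas block_measurable = tracker_measurable[OF block_0 block_Suc order_refl zero_le_one]
  and block_square = tracker_square[OF block_0 block_Suc order_refl zero_le_one]
  and block_sum = tracker_weighted_sum[OF block_0 block_Suc order_refl zero_le_one]

definition block_max :: "nat \<Rightarrow> nat \<Rightarrow> 'w \<Rightarrow> real" where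
  "block_max m n \<omega> = running_max (\<lambda>j. norm (block m j \<omega>)) n"

lemma block_max_nonneg: "0 \<le> block_max m n \<omega>"
  unfolding block_max_def by (rule running_max_nonneg) simp

lemma block_max_measurable: "block_max m n \<in> borel_measurable (Fs (m + n))"
proof (induction n)
  case 0
  have "block_max m 0 = (\<lambda>_. 0)" by (auto simp: block_max_def block_0)
  then show ?case by simp
next
  case (Suc n)
  have [measurable]: "block_max m n \<in> borel_measurable (Fs (m + Suc n))"
    using measurable_Fs_mono[OF Suc] by simp
  have [measurable]: "block m (Suc n) \<in> borel_measurable (Fs (m + Suc n))"
    by (rule block_measurable)
  have "block_max m (Suc n) = (\<lambda>\<omega>. max (block_max m n \<omega>) (norm (block m (Suc n) \<omega>)))"
    by (auto simp: block_max_def)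
  then show ?case by (simp only:) measurable
qed

lemma block_max_square_integrable: "integrable M (\<lambda>\<omega>. (block_max m n \<omega>)^2)"
proof (induction n)
  case 0
  show ?case by (simp add: block_max_def block_0)
next
  case (Suc n)
  show ?case
  proof (rule Bochner_Integration.integrable_bound)
    show "integrable M (\<lambda>\<omega>. (block_max m n \<omega>)^2 + norm (block m (Suc n) \<omega>)^2)"
      using Suc block_square by (intro Bochner_Integration.integrable_add) auto
    show "(\<lambda>\<omega>. (block_max m (Suc n) \<omega>)^2) \<in> borel_measurable M"
      using measurable_Fs_M[OF block_max_measurable] by measurable
    show "AE \<omega> in M. norm ((block_max m (Suc n) \<omega>)^2)
        \<le> norm ((block_max m n \<omega>)^2 + norm (block m (Suc n) \<omega>)^2)"
      by (auto simp: block_max_def max_def)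
  qed
qed

lemma block_maximal_inequality: "(\<integral>\<omega>. (block_max m n \<omega>)^2 \<partial>M) \<le> 4 * (\<Sum>k<n. c (m + k))"
proof -
  define V where "V k \<omega> = block_max m k \<omega> *\<^sub>R sgn (block m k \<omega>)" for k \<omega>
  have V_meas: "V k \<in> borel_measurable (Fs (m + k))" for k
    unfolding V_def sgn_div_norm using block_max_measurable[of m k] block_measurable[of m k]
    by measurable
  have V_int: "integrable M (\<lambda>\<omega>. norm (V k \<omega>)^2)" for k
  proof (rule Bochner_Integration.integrable_bound[OF block_max_square_integrable[of m k]])
    show "(\<lambda>\<omega>. norm (V k \<omega>)^2) \<in> borel_measurable M"
      using measurable_Fs_M[OF V_meas] by measurable
    show "AE \<omega> in M. norm (norm (V k \<omega>)^2) \<le> norm ((block_max m k \<omega>)^2)"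
      by (auto simp: V_def norm_sgn)
  qed
  have Vd_int: "integrable M (\<lambda>\<omega>. V k \<omega> \<bullet> d (m + k) \<omega>)" for k
    by (intro integrable_inner_of_square_integrable V_int d_int measurable_Fs_M[OF V_meas]
        measurable_Fs_M[OF d_meas])
  have path: "(block_max m n \<omega>)^2
      \<le> 4 * norm (block m n \<omega>)^2 - 4 * (\<Sum>k<n. V k \<omega> \<bullet> d (m + k) \<omega>)" for \<omega>
  proof -
    have "V k \<omega> \<bullet> d (m + k) \<omega>
        \<le> block_max m k \<omega> * (norm (block m (Suc k) \<omega>) - norm (block m k \<omega>))" for k
    proof -
      let ?B = "block m k \<omega>" and ?d = "d (m + k) \<omega>"
      have "sgn ?B \<bullet> (?B + ?d) \<le> norm (sgn ?B) * norm (?B + ?d)" by (rule norm_cauchy_schwarz)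
      also have "\<dots> \<le> 1 * norm (?B + ?d)" by (intro mult_right_mono) (auto simp: norm_sgn)
      also have "sgn ?B \<bullet> (?B + ?d) = norm ?B + sgn ?B \<bullet> ?d"
        by (cases "?B = 0")
          (auto simp: inner_add_right sgn_div_norm power2_eq_square simp flip: power2_norm_eq_inner)
      finally have "sgn ?B \<bullet> ?d \<le> norm (block m (Suc k) \<omega>) - norm ?B" by (simp add: block_Suc)
      then show ?thesis
        unfolding V_def inner_scaleR_left by (intro mult_left_mono block_max_nonneg)
    qed
    then have "(\<Sum>k<n. V k \<omega> \<bullet> d (m + k) \<omega>)
        \<le> (\<Sum>k<n. block_max m k \<omega> * (norm (block m (Suc k) \<omega>) - norm (block m k \<omega>)))"
      by (rule sum_mono)
    then show ?thesis
      using running_max_square_le[of "\<lambda>j. norm (block m j \<omega>)" n] unfolding block_max_def by linarith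
  qed
  have "(\<integral>\<omega>. (block_max m n \<omega>)^2 \<partial>M)
      \<le> (\<integral>\<omega>. 4 * norm (block m n \<omega>)^2 - 4 * (\<Sum>k<n. V k \<omega> \<bullet> d (m + k) \<omega>) \<partial>M)"
    using block_square[of m n] Vd_int path
    by (intro integral_mono block_max_square_integrable Bochner_Integration.integrable_diff
        integrable_mult_right Bochner_Integration.integrable_sum) auto
  also have "\<dots> = 4 * (\<integral>\<omega>. norm (block m n \<omega>)^2 \<partial>M) - 4 * (\<Sum>k<n. \<integral>\<omega>. V k \<omega> \<bullet> d (m + k) \<omega> \<partial>M)"
    using block_square[of m n] Vd_int by simp
  also have "\<dots> = 4 * (\<integral>\<omega>. norm (block m n \<omega>)^2 \<partial>M)" by (simp add: d_orth V_meas V_int)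
  finally show ?thesis using block_sum[of m n] by simp
qed

text \<open>\<open>X m\<close> controls the oscillation of the partial sums after \<open>m\<close>.
  Its expectation is at most four times a tail of \<open>c\<close>, so the infimum over
  \<open>m\<close> has expectation zero.\<close>

lemma AE_noise_summable: "AE \<omega> in M. summable (\<lambda>k. d k \<omega>)"
proof -
  define X where "X m \<omega> = (SUP n. ennreal ((block_max m n \<omega>)^2))" for m \<omega>
  have [measurable]: "block_max m n \<in> borel_measurable M" for m n
    by (rule measurable_Fs_M[OF block_max_measurable])
  have X_meas[measurable]: "X m \<in> borel_measurable M" for m unfolding X_def by measurable
  have X_int: "(\<integral>\<^sup>+\<omega>. X m \<omega> \<partial>M) \<le> ennreal (4 * (\<Sum>k. c (k + m)))" for m
  proof -
    have "(\<integral>\<^sup>+\<omega>. X m \<omega> \<partial>M) = (SUP n. \<integral>\<^sup>+\<omega>. ennreal ((block_max m n \<omega>)^2) \<partial>M)"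
      unfolding X_def
    proof (rule nn_integral_monotone_convergence_SUP)
      show "incseq (\<lambda>n \<omega>. ennreal ((block_max m n \<omega>)^2))"
        using block_max_nonneg
        by (auto simp: incseq_def le_fun_def block_max_def intro!: ennreal_leI power_mono running_max_mono)
    qed measurable
    also have "\<dots> \<le> ennreal (4 * (\<Sum>k. c (k + m)))"
    proof (rule SUP_least)
      fix n
      have "(\<integral>\<^sup>+\<omega>. ennreal ((block_max m n \<omega>)^2) \<partial>M) = ennreal (\<integral>\<omega>. (block_max m n \<omega>)^2 \<partial>M)"
        by (intro nn_integral_eq_integral block_max_square_integrable) simp
      also have "\<dots> \<le> ennreal (4 * (\<Sum>k. c (k + m)))"
      proof (rule ennreal_leI, rule order_trans[OF block_maximal_inequality], rule mult_left_mono)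
        have "(\<Sum>k<n. c (k + m)) \<le> (\<Sum>k. c (k + m))"
          using c_sum c_nonneg by (intro sum_le_suminf) (auto simp: summable_iff_shift)
        then show "(\<Sum>k<n. c (m + k)) \<le> (\<Sum>k. c (k + m))" by (simp add: add.commute)
      qed simp
      finally show "(\<integral>\<^sup>+\<omega>. ennreal ((block_max m n \<omega>)^2) \<partial>M) \<le> ennreal (4 * (\<Sum>k. c (k + m)))" .
    qed
    finally show ?thesis .
  qed
  have "(\<integral>\<^sup>+\<omega>. (INF m. X m \<omega>) \<partial>M) \<le> ennreal (4 * (\<Sum>k. c (k + m)))" for m
    by (rule order_trans[OF nn_integral_mono X_int]) (rule INF_lower, simp)
  moreover have "(\<lambda>m. ennreal (4 * (\<Sum>k. c (k + m)))) \<longlonglongrightarrow> ennreal (4 * 0)"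
    by (intro tendsto_ennrealI tendsto_intros suminf_exist_split2 c_sum)
  ultimately have "(\<integral>\<^sup>+\<omega>. (INF m. X m \<omega>) \<partial>M) \<le> ennreal (4 * 0)"
    by (intro LIMSEQ_le_const) auto
  then have "AE \<omega> in M. (INF m. X m \<omega>) = 0"
    by (subst nn_integral_0_iff_AE[symmetric]) auto
  then show ?thesis
  proof eventually_elim
    case (elim \<omega>)
    have "Cauchy (\<lambda>n. \<Sum>k<n. d k \<omega>)"
    proof (rule metric_CauchyI)
      fix e :: real assume e: "e > 0"
      \<comment> \<open>Some \<open>m\<close> has later oscillation below \<open>e / 2\<close>; two
        later partial sums are compared through the one at \<open>m\<close>.\<close>
      have "(INF m. X m \<omega>) < ennreal ((e / 2)^2)" using elim e by (simp add: ennreal_zero_less_divide)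
      then obtain m where m: "X m \<omega> < ennreal ((e / 2)^2)" by (auto simp: INF_less_iff)
      have near: "norm ((\<Sum>k<m + j. d k \<omega>) - (\<Sum>k<m. d k \<omega>)) < e / 2" for j
      proof -
        have "ennreal ((block_max m j \<omega>)^2) < ennreal ((e / 2)^2)"
          using m unfolding X_def by (meson SUP_upper UNIV_I le_less_trans)
        then have "(block_max m j \<omega>)^2 < (e / 2)^2" by (subst (asm) ennreal_less_iff) auto
        then have "block_max m j \<omega> < e / 2" by (rule power_less_imp_less_base) (use e in auto)
        moreover have "norm (block m j \<omega>) \<le> block_max m j \<omega>"
          unfolding block_max_def by (rule le_running_max) simp
        moreover have "(\<Sum>k<m + j. d k \<omega>) - (\<Sum>k<m. d k \<omega>) = block m j \<omega>"
          by (induction j) (auto simp: block_def algebra_simps)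
        ultimately show ?thesis by simp
      qed
      show "\<exists>N. \<forall>i\<ge>N. \<forall>j\<ge>N. dist (\<Sum>k<i. d k \<omega>) (\<Sum>k<j. d k \<omega>) < e"
      proof (intro exI allI impI)
        fix i j assume ij: "m \<le> i" "m \<le> j"
        show "dist (\<Sum>k<i. d k \<omega>) (\<Sum>k<j. d k \<omega>) < e"
          using near[of "i - m"] near[of "j - m"] ij
            dist_triangle_half_l[of "\<Sum>k<i. d k \<omega>" "\<Sum>k<m. d k \<omega>" e "\<Sum>k<j. d k \<omega>"]
          by (simp add: dist_norm)
      qed
    qed
    then show ?case
      by (simp add: summable_iff_convergent Cauchy_convergent_iff)
  qed
qed

end

subsection \<open>Smoothness along the trajectory\<close>

text \<open>The strict bound on the \<open>Limsup\<close> gives a Lipschitz estimate near every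
  point of the segment. \<open>Bolzano\<close> glues these, because the estimate adds up over
  adjacent intervals.\<close>

lemma lip_less_imp_lipschitz:
  fixes G :: "'a::real_normed_vector \<Rightarrow> 'b::real_normed_vector"
  assumes "convex C" and lip: "\<And>p. p \<in> C \<Longrightarrow> lip G p < ereal K" and xy: "x \<in> C" "y \<in> C"
  shows "norm (G y - G x) \<le> K * norm (y - x)"
proof -
  define p where "p t = x + t *\<^sub>R (y - x)" for t :: real
  have p_diff: "p b - p a = (b - a) *\<^sub>R (y - x)" for a b by (simp add: p_def algebra_simps)
  have "norm (G (p 1) - G (p 0)) \<le> K * norm (y - x) * (1 - 0)"
  proof (rule Bolzano[where P = "\<lambda>a b. norm (G (p b) - G (p a)) \<le> K * norm (y - x) * (b - a)"])
    fix a b c :: real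
    assume trans: "norm (G (p b) - G (p a)) \<le> K * norm (y - x) * (b - a)"
      "norm (G (p c) - G (p b)) \<le> K * norm (y - x) * (c - b)"
    have "norm (G (p c) - G (p a)) \<le> norm (G (p c) - G (p b)) + norm (G (p b) - G (p a))"
      using norm_triangle_ineq[of "G (p c) - G (p b)" "G (p b) - G (p a)"] by simp
    then show "norm (G (p c) - G (p a)) \<le> K * norm (y - x) * (c - a)"
      using trans by (simp add: algebra_simps)
  next
    fix t :: real assume t: "0 \<le> t" "t \<le> 1"
    have "p t = (1 - t) *\<^sub>R x + t *\<^sub>R y" by (simp add: p_def algebra_simps)
    then have pC: "p t \<in> C" using assms(1) xy t by (simp add: convexD)
    have "eventually (\<lambda>q. norm (G (fst q) - G (snd q)) / norm (fst q - snd q) < K)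
        (at (p t, p t) within {q. fst q \<noteq> snd q})"
      using Limsup_lessD[OF lip[OF pC, unfolded lip_def]] by (simp add: case_prod_beta)
    then obtain \<delta> where \<delta>: "\<delta> > 0"
      "\<And>u v. u \<noteq> v \<Longrightarrow> dist (u, v) (p t, p t) < \<delta> \<Longrightarrow> norm (G u - G v) / norm (u - v) < K"
      unfolding eventually_at by auto
    show "\<exists>d>0. \<forall>a b. a \<le> t \<and> t \<le> b \<and> b - a < d \<longrightarrow>
        norm (G (p b) - G (p a)) \<le> K * norm (y - x) * (b - a)"
    proof (intro exI conjI allI impI)
      \<comment> \<open>Adding one keeps the denominator positive when \<open>x = y\<close>.\<close>
      show "0 < \<delta> / (norm (y - x) + 1)" using \<delta>(1) by (simp add: add_nonneg_pos)
      fix a b :: real assume ab: "a \<le> t \<and> t \<le> b \<and> b - a < \<delta> / (norm (y - x) + 1)"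
      show "norm (G (p b) - G (p a)) \<le> K * norm (y - x) * (b - a)"
      \<comment> \<open>The filter in \<open>lip\<close> excludes the diagonal, so coinciding points
        are treated separately; there both sides vanish.\<close>
      proof (cases "p a = p b")
        case True
        then have "norm (y - x) * (b - a) = 0" using p_diff[of b a] by auto
        then have "K * norm (y - x) * (b - a) = 0" by (simp only: mult.assoc mult_zero_right)
        then show ?thesis by (simp only: True diff_self norm_zero order_refl)
      next
        case False
        have "dist (p b, p a) (p t, p t) \<le> dist (p b) (p t) + dist (p a) (p t)"
          unfolding dist_Pair_Pair by (rule sqrt_sum_squares_le_sum) auto
        also have "\<dots> = (b - a) * norm (y - x)"
          unfolding dist_norm p_diff norm_scaleR using ab by (simp add: abs_if left_diff_distrib)
        also have "\<dots> \<le> (b - a) * (norm (y - x) + 1)" using ab by (intro mult_left_mono) auto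
        also have "\<dots> < \<delta>" using ab by (simp add: pos_less_divide_eq add_nonneg_pos)
        finally have "norm (G (p b) - G (p a)) / norm (p b - p a) < K" using \<delta>(2) False by metis
        then have "norm (G (p b) - G (p a)) \<le> K * norm (p b - p a)"
          using False by (simp add: pos_divide_less_eq)
        then show ?thesis unfolding p_diff norm_scaleR using ab by (simp add: mult_ac)
      qed
    qed
  qed simp
  then show ?thesis by (simp add: p_def)
qed

text \<open>The mean value theorem on the segment gives one intermediate gradient, at distance at
  most \<open>norm (y - x)\<close> from \<open>x\<close>; this is why the constant is
  \<open>K\<close>.\<close>

lemma lipschitz_gradient_descent:
  fixes f :: "'a::real_inner \<Rightarrow> real"
  assumes "convex D" and grad: "\<And>p. p \<in> D \<Longrightarrow> GDERIV f p :> gf p"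
    and gf: "\<And>u v. u \<in> D \<Longrightarrow> v \<in> D \<Longrightarrow> norm (gf v - gf u) \<le> K * norm (v - u)"
    and "K \<ge> 0" and xy: "x \<in> D" "y \<in> D"
  shows "f y \<le> f x + gf x \<bullet> (y - x) + K * norm (y - x)^2"
proof -
  define p where "p t = x + t *\<^sub>R (y - x)" for t :: real
  have pD: "p t \<in> D" if "0 \<le> t" "t \<le> 1" for t
  proof -
    have "p t = (1 - t) *\<^sub>R x + t *\<^sub>R y" by (simp add: p_def algebra_simps)
    then show ?thesis using assms(1) xy that by (simp add: convexD)
  qed
  have "DERIV (\<lambda>t. f (p t)) t :> (y - x) \<bullet> gf (p t)" if "0 \<le> t" "t \<le> 1" for t
  proof -
    have "(p has_derivative (\<lambda>h. h *\<^sub>R (y - x))) (at t)"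
      unfolding p_def by (auto intro!: derivative_eq_intros)
    moreover have "(f has_derivative (\<lambda>h. h \<bullet> gf (p t))) (at (p t))"
      using grad[OF pD[OF that]] by (simp add: gderiv_def)
    ultimately have "((\<lambda>t. f (p t)) has_derivative (\<lambda>h. (h *\<^sub>R (y - x)) \<bullet> gf (p t))) (at t)"
      by (rule has_derivative_compose)
    then show ?thesis by (simp add: has_field_derivative_def mult_commute_abs)
  qed
  then obtain t where t: "0 < t" "t < 1" "f (p 1) - f (p 0) = (1 - 0) * ((y - x) \<bullet> gf (p t))"
    using MVT2[of 0 1 "\<lambda>t. f (p t)" "\<lambda>t. (y - x) \<bullet> gf (p t)"] by auto
  have "f y - f x = gf x \<bullet> (y - x) + (gf (p t) - gf x) \<bullet> (y - x)"
    using t(3) by (simp add: p_def inner_commute inner_diff_left inner_diff_right)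
  also have "(gf (p t) - gf x) \<bullet> (y - x) \<le> norm (gf (p t) - gf x) * norm (y - x)"
    by (rule norm_cauchy_schwarz)
  also have "\<dots> \<le> (K * norm (y - x)) * norm (y - x)"
  proof (rule mult_right_mono)
    have "norm (gf (p t) - gf x) \<le> K * norm (p t - x)" using t xy by (intro gf pD) auto
    also have "\<dots> \<le> K * norm (y - x)"
      using t \<open>K \<ge> 0\<close> by (intro mult_left_mono) (auto simp: p_def mult_left_le_one_le)
    finally show "norm (gf (p t) - gf x) \<le> K * norm (y - x)" .
  qed simp
  finally show ?thesis by (simp add: power2_eq_square)
qed

subsection \<open>Almost sure convergence\<close>

lemma prox_map_prox:
  fixes \<phi> :: "'a::euclidean_space \<Rightarrow> ereal"
  assumes "proper_fun \<phi>" "convex_efun \<phi>" "lsc_efun \<phi>" "lam > 0"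
  shows "prox_map (edom \<phi>) (prox lam \<phi>) (\<lambda>u. real_of_ereal (\<phi> u)) lam"
  using assms prox_in_edom[OF assms] prox_variational[OF assms] by unfold_locales auto

text \<open>Needed because \<open>f\<close> and \<open>gf\<close> are arbitrary outside
  \<open>U\<close>, while the iterates never leave it.\<close>

lemma borel_measurable_continuous_on_open_compose:
  fixes h :: "'a::topological_space \<Rightarrow> 'b::topological_space"
  assumes "open U" "continuous_on U h" "u \<in> borel_measurable M" "\<And>\<omega>. u \<omega> \<in> U"
  shows "(\<lambda>\<omega>. h (u \<omega>)) \<in> borel_measurable M"
proof (rule measurable_compose[where N = "restrict_space borel U"])
  show "u \<in> measurable M (restrict_space borel U)"
    using assms by (intro measurable_restrict_space2) auto
  show "h \<in> borel_measurable (restrict_space borel U)"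
    using assms(2) by (rule borel_measurable_continuous_on_restrict)
qed

lemma borel_measurable_lsc_efun:
  assumes "lsc_efun \<phi>"
  shows "\<phi> \<in> borel_measurable borel"
proof -
  have "\<phi> -` {..a} \<in> sets borel" for a
    using assms lsc_efun_iff_closed_sublevel[of \<phi>] by (auto simp: vimage_def intro: borel_closed)
  then show ?thesis unfolding borel_measurable_iff_Iic_ereal by simp
qed

theorem theorem2p13:
  fixes M :: "'w measure" and Fs :: "nat \<Rightarrow> 'w measure"
    and \<phi> :: "'a::euclidean_space \<Rightarrow> ereal" and f :: "'a \<Rightarrow> real" and gf :: "'a \<Rightarrow> 'a"
    and U :: "'a set" and lam :: real and \<alpha> :: "nat \<Rightarrow> real" and \<sigma> :: "nat \<Rightarrow> real"
    and z0 :: 'a and g :: "nat \<Rightarrow> 'w \<Rightarrow> 'a" and z x :: "nat \<Rightarrow> 'w \<Rightarrow> 'a"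
  assumes prob: "prob_space M"
    and filt: "filtration (space M) Fs" and sub: "\<And>k. subalgebra M (Fs k)"
    and phi: "proper_fun \<phi>" "convex_efun \<phi>" "lsc_efun \<phi>"
    and U: "open U" "edom \<phi> \<subseteq> U"
    and f_grad: "\<And>y. y \<in> U \<Longrightarrow> GDERIV f y :> gf y"
    and gf_cont: "continuous_on U gf"
    and lam: "lam > 0"
    and alpha_pos: "\<And>k. \<alpha> k > 0"
    and z_0: "\<And>\<omega>. z 0 \<omega> = z0"
    and z_Suc: "\<And>k \<omega>. z (Suc k) \<omega> = z k \<omega> - \<alpha> k *\<^sub>R (g k \<omega> + env_grad lam \<phi> (z k \<omega>))"
    and x_def: "\<And>k \<omega>. x k \<omega> = prox lam \<phi> (z k \<omega>)"
    and g_meas: "\<And>k. g k \<in> borel_measurable (Fs (Suc k))"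
    (* (A.1) *)
    and A1: "\<exists>\<psi>b::real. \<forall>y \<in> edom \<phi>. ereal \<psi>b \<le> ereal (f y) + \<phi> y"
    (* (A.2) *)
    and g_int: "\<And>k. integrable M (g k)"
    and A2_cond: "\<And>k b. b \<in> Basis \<Longrightarrow>
                   AE \<omega> in M. real_cond_exp M (Fs k) (\<lambda>\<omega>. g k \<omega> \<bullet> b) \<omega> = gf (x k \<omega>) \<bullet> b"
    and sigma_nonneg: "\<And>k. \<sigma> k \<ge> 0"
    and A2_var: "\<And>k. (\<integral>\<^sup>+ \<omega>. ennreal ((norm (g k \<omega> - gf (x k \<omega>)))\<^sup>2) \<partial>M) \<le> ennreal ((\<sigma> k)\<^sup>2)"
    (* (A.3) *)
    and A3: "filterlim (\<lambda>n. \<Sum>k<n. \<alpha> k) at_top sequentially" "\<alpha> \<longlonglongrightarrow> 0"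
    (* (A.4) *)
    and A4: "\<exists>\<beta>::nat \<Rightarrow> real. (\<forall>k. \<beta> k > 0) \<and> (\<exists>K. \<forall>k\<ge>K. \<beta> k \<le> \<beta> (Suc k))
               \<and> summable (\<lambda>k. (\<alpha> k)\<^sup>2 * (\<beta> k)\<^sup>2 * (\<sigma> k)\<^sup>2)"
  shows "\<exists>\<psi>s :: 'w \<Rightarrow> real. \<psi>s \<in> borel_measurable M \<and>
           (AE \<omega> in M.
              (SUP xb \<in> closure (convex hull (range (\<lambda>k. x k \<omega>))). lip gf xb) < \<infinity> \<longrightarrow>
                ((\<lambda>k. F_nor lam \<phi> gf (z k \<omega>)) \<longlonglongrightarrow> 0) \<and>
                ((\<lambda>k. F_nat lam \<phi> gf (x k \<omega>)) \<longlonglongrightarrow> 0) \<and>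
                ((\<lambda>k. ereal (f (x k \<omega>)) + \<phi> (x k \<omega>)) \<longlonglongrightarrow> ereal (\<psi>s \<omega>)))"
proof -
  interpret prob_space M by (rule prob)
  interpret full: prox_map "edom \<phi>" "prox lam \<phi>" "\<lambda>u. real_of_ereal (\<phi> u)" lam
    by (rule prox_map_prox[OF phi lam])

  \<comment> \<open>Measurability of the iterates\<close>
  have x_dom: "x k \<omega> \<in> edom \<phi>" for k \<omega> unfolding x_def by (rule full.P_in)
  then have x_U: "x k \<omega> \<in> U" for k \<omega> using U(2) by blast
  have "1-lipschitz_on UNIV (prox lam \<phi>)"
    using full.nonexpansive by (intro lipschitz_onI) (auto simp: dist_norm)
  then have prox_meas[measurable]: "prox lam \<phi> \<in> borel_measurable borel"
    by (intro borel_measurable_continuous_onI lipschitz_on_continuous_on)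
  have z_meas: "z k \<in> borel_measurable (Fs k)" for k
  proof (induction k)
    case 0
    have "z 0 = (\<lambda>_. z0)" using z_0 by auto
    then show ?case by simp
  next
    case (Suc k)
    have "subalgebra (Fs (Suc k)) (Fs k)" using filt by (simp add: subalgebra_def filtration_def)
    then have [measurable]: "z k \<in> borel_measurable (Fs (Suc k))"
      using Suc by (rule measurable_from_subalg)
    note [measurable] = g_meas[of k]
    have "z (Suc k) = (\<lambda>\<omega>. z k \<omega> - \<alpha> k *\<^sub>R (g k \<omega> + (1 / lam) *\<^sub>R (z k \<omega> - prox lam \<phi> (z k \<omega>))))"
      using z_Suc by (auto simp: env_grad_def)
    then show ?case by simp
  qed
  have x_meas: "x k \<in> borel_measurable (Fs k)" for k
  proof -
    note [measurable] = z_meas[of k]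
    have "x k = (\<lambda>\<omega>. prox lam \<phi> (z k \<omega>))" using x_def by auto
    then show ?thesis by simp
  qed
  have gfx_meas: "(\<lambda>\<omega>. gf (x k \<omega>)) \<in> borel_measurable (Fs k)" for k
    by (rule borel_measurable_continuous_on_open_compose[OF U(1) gf_cont x_meas x_U])

  \<comment> \<open>Second moments of the gradient errors\<close>
  define e where "e k \<omega> = g k \<omega> - gf (x k \<omega>)" for k \<omega>
  have e_meas: "e k \<in> borel_measurable (Fs (Suc k))" for k
  proof -
    have "subalgebra (Fs (Suc k)) (Fs k)" using filt by (simp add: subalgebra_def filtration_def)
    then have "(\<lambda>\<omega>. gf (x k \<omega>)) \<in> borel_measurable (Fs (Suc k))"
      using gfx_meas by (rule measurable_from_subalg)
    with g_meas[of k] show ?thesis unfolding e_def by measurable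
  qed
  have e_measM: "e k \<in> borel_measurable M" for k
    by (rule measurable_from_subalg[OF sub e_meas])
  have e_int: "integrable M (\<lambda>\<omega>. norm (e k \<omega>)^2)" for k
  proof (rule integrableI_bounded)
    show "(\<lambda>\<omega>. norm (e k \<omega>)^2) \<in> borel_measurable M" using e_measM[of k] by measurable
    show "(\<integral>\<^sup>+\<omega>. ennreal (norm (norm (e k \<omega>)^2)) \<partial>M) < \<infinity>"
      using A2_var[of k] by (simp add: e_def) (metis ennreal_less_top le_less_trans)
  qed
  have e_var: "(\<integral>\<omega>. norm (e k \<omega>)^2 \<partial>M) \<le> (\<sigma> k)^2" for k
  proof -
    have "ennreal (\<integral>\<omega>. norm (e k \<omega>)^2 \<partial>M) \<le> ennreal ((\<sigma> k)^2)"
      using A2_var[of k] by (subst nn_integral_eq_integral[symmetric, OF e_int]) (auto simp: e_def)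
    then show ?thesis by simp
  qed

  \<comment> \<open>Weighted errors as square-integrable noise\<close>
  define d where "d k \<omega> = \<alpha> k *\<^sub>R e k \<omega>" for k \<omega>
  define c where "c k = (\<alpha> k)^2 * (\<sigma> k)^2" for k
  have c_sum: "summable c"
  proof -
    obtain \<beta> K where \<beta>: "\<And>k. \<beta> k > (0::real)" "\<And>k. k \<ge> K \<Longrightarrow> \<beta> k \<le> \<beta> (Suc k)"
      "summable (\<lambda>k. (\<alpha> k)\<^sup>2 * (\<beta> k)\<^sup>2 * (\<sigma> k)\<^sup>2)" using A4 by blast
    \<comment> \<open>From \<open>K\<close> on, \<beta> stays above the positive constant
      \<open>\<beta> K\<close>, and dividing by its square removes \<beta> from the series.\<close>
    have \<beta>K: "\<beta> K \<le> \<beta> k" if "K \<le> k" for k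
      using that by (induction rule: dec_induct) (use \<beta>(2) order_trans in blast)+
    show ?thesis
    proof (rule summable_comparison_test'[where N = K])
      show "summable (\<lambda>k. (1 / (\<beta> K)^2) * ((\<alpha> k)\<^sup>2 * (\<beta> k)\<^sup>2 * (\<sigma> k)\<^sup>2))"
        by (rule summable_mult[OF \<beta>(3)])
      fix k assume "K \<le> k"
      then have "(\<beta> K)^2 \<le> (\<beta> k)^2" using \<beta>K \<beta>(1)[of K] by (intro power_mono) auto
      then have "1 \<le> (\<beta> k)^2 / (\<beta> K)^2" using \<beta>(1)[of K] by (simp add: field_simps)
      then have "c k * 1 \<le> c k * ((\<beta> k)^2 / (\<beta> K)^2)" by (intro mult_left_mono) (auto simp: c_def)
      then show "norm (c k) \<le> (1 / (\<beta> K)^2) * ((\<alpha> k)\<^sup>2 * (\<beta> k)\<^sup>2 * (\<sigma> k)\<^sup>2)"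
        by (simp add: c_def mult_ac)
    qed
  qed
  interpret noise: square_integrable_noise M Fs d c
  proof (intro square_integrable_noise.intro square_integrable_noise_axioms.intro)
    show "d k \<in> borel_measurable (Fs (Suc k))" for k
      unfolding d_def using e_meas[of k] by measurable
    show "integrable M (\<lambda>\<omega>. norm (d k \<omega>)^2)" for k
      using e_int[of k] by (simp add: d_def power_mult_distrib)
    show "(\<integral>\<omega>. norm (d k \<omega>)^2 \<partial>M) \<le> c k" for k
      using e_var[of k] by (simp add: d_def c_def power_mult_distrib mult_left_mono)
    fix k and V :: "'w \<Rightarrow> 'a"
    assume "V \<in> borel_measurable (Fs k)" "integrable M (\<lambda>\<omega>. norm (V \<omega>)^2)"
    then have "(\<integral>\<omega>. V \<omega> \<bullet> (g k \<omega> - gf (x k \<omega>)) \<partial>M) = 0"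
      using e_int[of k] unfolding e_def
      by (intro cond_exp_centered_orth[OF prob sub[of k] g_int gfx_meas A2_cond])
    then show "(\<integral>\<omega>. V \<omega> \<bullet> d k \<omega> \<partial>M) = 0" by (simp add: d_def e_def)
  qed (use prob filt sub c_sum in auto)

  \<comment> \<open>Step sizes truncated to filter rates in the unit interval\<close>
  define a where "a k = min (\<alpha> k) 1" for k
  have a: "0 \<le> a k" "a k \<le> 1" "a k \<le> \<alpha> k" for k
    using alpha_pos[of k] by (auto simp: a_def)
  have "eventually (\<lambda>k. \<alpha> k < 1) sequentially" using order_tendstoD(2)[OF A3(2)] by simp
  then obtain N where "\<And>k. k \<ge> N \<Longrightarrow> \<alpha> k < 1" by (auto simp: eventually_sequentially)
  then have N: "a k = \<alpha> k" if "k \<ge> N" for k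
    using that by (simp add: a_def min_def less_imp_le)
  \<comment> \<open>Truncation changes only indices below \<open>N\<close>, which costs at most the
    sum of those \<alpha>.\<close>
  have a_div: "filterlim (\<lambda>n. \<Sum>k<n. a k) at_top sequentially"
  proof (rule filterlim_at_top_mono)
    show "filterlim (\<lambda>n. - (\<Sum>k<N. \<alpha> k) + (\<Sum>k<n. \<alpha> k)) at_top sequentially"
      by (rule filterlim_tendsto_add_at_top[OF tendsto_const A3(1)])
    have "(\<Sum>k<n. \<alpha> k) \<le> (\<Sum>k<n. a k) + (\<Sum>k<N. \<alpha> k)" for n
    proof -
      have "(\<Sum>k<n. \<alpha> k) \<le> (\<Sum>k<n. a k + (if k < N then \<alpha> k else 0))"
        using N a by (intro sum_mono) (auto simp: not_less)
      also have "\<dots> = (\<Sum>k<n. a k) + (\<Sum>k\<in>{..<n} \<inter> {..<N}. \<alpha> k)"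
        by (simp add: sum.distrib sum.If_cases Int_def)
      also have "(\<Sum>k\<in>{..<n} \<inter> {..<N}. \<alpha> k) \<le> (\<Sum>k<N. \<alpha> k)"
        using alpha_pos by (intro sum_mono2) (auto intro: less_imp_le)
      finally show ?thesis by simp
    qed
    then show "\<forall>\<^sub>F n in sequentially. - (\<Sum>k<N. \<alpha> k) + (\<Sum>k<n. \<alpha> k) \<le> (\<Sum>k<n. a k)"
      by (simp add: algebra_simps)
  qed

  define w where "w = rec_nat (\<lambda>_. 0) (\<lambda>k u \<omega>. (1 - a k) *\<^sub>R u \<omega> + d k \<omega>)"
  \<comment> \<open>\<open>0 + k\<close> matches the tracker recursion with starting index
    zero.\<close>
  have w_0: "w 0 \<omega> = 0" and w_Suc: "w (Suc k) \<omega> = (1 - a k) *\<^sub>R w k \<omega> + d (0 + k) \<omega>" for k \<omega>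
    by (simp_all add: w_def)
  have w_sum: "AE \<omega> in M. summable (\<lambda>k. a k * norm (w k \<omega>)^2)"
    by (rule noise.AE_tracker_summable[OF w_0 w_Suc a(1,2)])

  \<comment> \<open>Objective values along the iterates\<close>
  define \<psi> where "\<psi> k \<omega> = f (x k \<omega>) + real_of_ereal (\<phi> (x k \<omega>))" for k \<omega>
  have \<psi>: "ereal (f (x k \<omega>)) + \<phi> (x k \<omega>) = ereal (\<psi> k \<omega>)" for k \<omega>
    using proper_fun_eq_ereal[OF phi(1) x_dom] by (simp add: \<psi>_def) (metis plus_ereal.simps(1))
  have \<psi>_meas[measurable]: "\<psi> k \<in> borel_measurable M" for k
  proof -
    have [measurable]: "x k \<in> borel_measurable M" by (rule measurable_from_subalg[OF sub x_meas])
    have "continuous_on U f"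
      using f_grad by (intro continuous_at_imp_continuous_on ballI)
        (auto simp: gderiv_def dest: has_derivative_continuous)
    then have [measurable]: "(\<lambda>\<omega>. f (x k \<omega>)) \<in> borel_measurable M"
      by (rule borel_measurable_continuous_on_open_compose[OF U(1) _ _ x_U]) measurable
    note [measurable] = borel_measurable_lsc_efun[OF phi(3)]
    show ?thesis unfolding \<psi>_def by measurable
  qed
  obtain \<psi>b where \<psi>b: "\<And>y. y \<in> edom \<phi> \<Longrightarrow> ereal \<psi>b \<le> ereal (f y) + \<phi> y" using A1 by blast

  \<comment> \<open>Deterministic convergence on a single path\<close>
  have path: "((\<lambda>k. F_nor lam \<phi> gf (z k \<omega>)) \<longlonglongrightarrow> 0) \<and>
      ((\<lambda>k. F_nat lam \<phi> gf (x k \<omega>)) \<longlonglongrightarrow> 0) \<and> convergent (\<lambda>k. \<psi> k \<omega>)"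
    if w_sum: "summable (\<lambda>k. a k * norm (w k \<omega>)^2)" and d_sum: "summable (\<lambda>k. d k \<omega>)"
      and L: "(SUP xb \<in> closure (convex hull (range (\<lambda>k. x k \<omega>))). lip gf xb) < \<infinity>" for \<omega>
  proof -
    define C where "C = closure (convex hull (range (\<lambda>k. x k \<omega>)))"
    have C: "closed C" "convex C" by (simp_all add: C_def convex_closure convex_convex_hull)
    have xC: "x k \<omega> \<in> C" for k
      unfolding C_def by (rule subsetD[OF closure_subset], rule hull_inc) simp
    \<comment> \<open>A finite number strictly above the supremum, as
      \<open>lip_less_imp_lipschitz\<close> takes a strict bound.\<close>
    obtain n :: nat where "(SUP xb \<in> C. lip gf xb) < ereal (real n)"
      using L less_PInf_Ex_of_nat unfolding C_def by (metis less_irrefl)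
    then have lip: "lip gf p < ereal (real n)" if "p \<in> C" for p
      using that by (meson SUP_upper le_less_trans)
    define \<phi>C where "\<phi>C = restrict_efun C \<phi>"
    have phiC: "proper_fun \<phi>C" "convex_efun \<phi>C" "lsc_efun \<phi>C"
      unfolding \<phi>C_def using phi C xC[of 0] x_dom[of 0 \<omega>]
      by (auto intro!: proper_restrict_efun convex_restrict_efun lsc_restrict_efun)
    have dom: "edom \<phi>C = C \<inter> edom \<phi>" by (simp add: \<phi>C_def edom_restrict_efun)
    have proxC: "prox lam \<phi>C (z k \<omega>) = x k \<omega>" for k
      unfolding \<phi>C_def x_def using xC[of k] by (intro prox_restrict_efun phi lam) (simp add: x_def)
    interpret prox_map "edom \<phi>C" "prox lam \<phi>C" "\<lambda>u. real_of_ereal (\<phi>C u)" lam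
      by (rule prox_map_prox[OF phiC lam])
    have lipschitz: "norm (gf v - gf u) \<le> real n * norm (v - u)"
      if "u \<in> edom \<phi>C" "v \<in> edom \<phi>C" for u v
      using that by (intro lip_less_imp_lipschitz[OF C(2) lip]) (auto simp: dom)
    interpret normal_map "edom \<phi>C" "prox lam \<phi>C" "\<lambda>u. real_of_ereal (\<phi>C u)" lam f gf "real n" \<psi>b
    proof
      show "f v \<le> f u + gf u \<bullet> (v - u) + real n * norm (v - u)^2"
        if "u \<in> edom \<phi>C" "v \<in> edom \<phi>C" for u v
        using that U(2) convex_edom[OF phiC(2)] lipschitz
        by (intro lipschitz_gradient_descent[of "edom \<phi>C"] f_grad) (auto simp: dom)
      show "\<psi>b \<le> f u + real_of_ereal (\<phi>C u)" if "u \<in> edom \<phi>C" for u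
      proof -
        have u: "u \<in> C" "u \<in> edom \<phi>" using that by (auto simp: dom)
        have "ereal \<psi>b \<le> ereal (f u) + ereal (real_of_ereal (\<phi> u))"
          using \<psi>b[OF u(2)] proper_fun_eq_ereal[OF phi(1) u(2)] by metis
        then show ?thesis using u(1) by (simp add: \<phi>C_def restrict_efun_in)
      qed
    qed (use lipschitz in auto)
    have F_eq: "F (z k \<omega>) = F_nor lam \<phi> gf (z k \<omega>)" for k
      by (simp add: F_def F_nor_def proxC flip: x_def)
    have psi_eq: "psi (z k \<omega>) = \<psi> k \<omega>" for k
      unfolding psi_def \<psi>_def proxC using xC[of k] by (simp add: \<phi>C_def restrict_efun_in)
    have w_null: "(\<lambda>k. w k \<omega>) \<longlonglongrightarrow> 0"
      by (rule contraction_noise_null[OF _ d_sum a(1,2) a_div]) (simp add: w_Suc)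
    have "summable (\<lambda>k. \<alpha> k * norm (w k \<omega>)^2)"
      by (rule summable_comparison_test'[OF w_sum, of N]) (use N alpha_pos in \<open>auto simp: less_imp_le\<close>)
    note conv = normal_map_iteration_converges[of \<alpha> "\<lambda>k. z k \<omega>" "\<lambda>k. e k \<omega>" "\<lambda>k. w k \<omega>" a,
        OF alpha_pos A3(2,1) _ _ a(1,3) w_null this]
    have z_step: "z (Suc k) \<omega> = z k \<omega> - \<alpha> k *\<^sub>R (F (z k \<omega>) + e k \<omega>)" for k
      by (simp add: z_Suc F_eq F_nor_def env_grad_def e_def x_def algebra_simps)
    have w_step: "w (Suc k) \<omega> = (1 - a k) *\<^sub>R w k \<omega> + \<alpha> k *\<^sub>R e k \<omega>" for k
      by (simp add: w_Suc d_def)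
    have nor: "(\<lambda>k. F_nor lam \<phi> gf (z k \<omega>)) \<longlonglongrightarrow> 0"
      using conv(1)[OF z_step w_step] by (simp add: F_eq)
    \<comment> \<open>The residual is a difference of two proximal points whose arguments differ by
      \<open>lam\<close> times the normal map. The original proximal map is used, because the second
      point may leave \<open>C\<close>.\<close>
    have "norm (F_nat lam \<phi> gf (x k \<omega>)) \<le> lam * norm (F_nor lam \<phi> gf (z k \<omega>))" for k
    proof -
      have "norm (F_nat lam \<phi> gf (x k \<omega>)) \<le> norm (z k \<omega> - (x k \<omega> - lam *\<^sub>R gf (x k \<omega>)))"
        using full.nonexpansive[of "z k \<omega>"] by (simp add: F_nat_def x_def)
      also have "z k \<omega> - (x k \<omega> - lam *\<^sub>R gf (x k \<omega>)) = lam *\<^sub>R F_nor lam \<phi> gf (z k \<omega>)"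
        using lam by (simp add: F_nor_def x_def algebra_simps)
      finally show ?thesis using lam by simp
    qed
    then have "(\<lambda>k. F_nat lam \<phi> gf (x k \<omega>)) \<longlonglongrightarrow> 0"
      by (intro Lim_null_comparison[OF always_eventually
            tendsto_mult_right_zero[OF tendsto_norm_zero[OF nor], of lam]]) blast
    then show ?thesis using nor conv(2)[OF z_step w_step] by (simp add: psi_eq)
  qed

  show ?thesis
  proof (intro exI conjI)
    \<comment> \<open>\<open>lim\<close> is total, so one measurable function serves on the whole
      space; it matters only where the values converge.\<close>
    show "(\<lambda>\<omega>. lim (\<lambda>k. \<psi> k \<omega>)) \<in> borel_measurable M" by measurable
    show "AE \<omega> in M.
              (SUP xb \<in> closure (convex hull (range (\<lambda>k. x k \<omega>))). lip gf xb) < \<infinity> \<longrightarrow>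
                ((\<lambda>k. F_nor lam \<phi> gf (z k \<omega>)) \<longlonglongrightarrow> 0) \<and>
                ((\<lambda>k. F_nat lam \<phi> gf (x k \<omega>)) \<longlonglongrightarrow> 0) \<and>
                ((\<lambda>k. ereal (f (x k \<omega>)) + \<phi> (x k \<omega>)) \<longlonglongrightarrow> ereal (lim (\<lambda>k. \<psi> k \<omega>)))"
      using w_sum noise.AE_noise_summable
    proof eventually_elim
      case (elim \<omega>)
      show ?case using path[OF elim] by (auto simp: \<psi> convergent_LIMSEQ_iff)
    qed
  qed
qed

end
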